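(* Given any scheme of fat points $X=\sum_{i=1}^s m_iP_i\subseteq\mathbb{P}^n$ and any integer $d\ge1$, the regularity index of $X$ is subject to the bound $$r(X)\le\max\left\{d\cdot\left\lceil\frac{-1+\sum_{P_i\in Y}m_i}{\dim_K[R/I_Y]_d-1}\right\rceil\;\Big|\;Y\subseteq\operatorname{Supp}X\text{ and }|Y|\ge2\right\}.$$
   Context: $K$ is an arbitrary field, $\mathbb{P}^n=\mathbb{P}^n_K$ is a projective space with coordinate ring $R=K[x_0,\dots,x_n]$ (standard grading); points of $\mathbb{P}^n$ are represented by nonzero vectors of $K^{n+1}$. For a point $P$, $I_P\subset R$ is its homogeneous ideal. A fat point scheme $X=\sum_{i=1}^s m_iP_i$ is given by distinct points $P_1,\dots,P_s\in\mathbb{P}^n$ and positive integers $m_1,\dots,m_s$; it is the zero-dimensional subscheme defined by $I_X=\bigcap_{i=1}^s I_{P_i}^{m_i}$, with $\deg X=\sum_{i=1}^s\binom{m_i+n-1}{n}$, and $\operatorname{Supp}X=\{P_1,\dots,P_s\}$. The regularity index $r(X)$ is the least integer $j$ such that $\dim_K[R/I_X]_j=\deg X$ (equality then holds for all larger degrees). For a finite set of points $Y$, $I_Y=\bigcap_{P\in Y}I_P$ is its homogeneous ideal, and $[\,\cdot\,]_d$ denotes the degree $d$ component. *)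

theory Defs
  imports
    "HOL-Library.Poly_Mapping"
    "HOL-Analysis.Finite_Cartesian_Product"
begin

text \<open>
  The polynomial ring R = K[x_0,...,x_n] is the type of finitely supported maps from exponent
  vectors to K, with the variables indexed by a finite type \<open>'v\<close>; so n + 1 = CARD('v), and the
  points of projective n-space are represented by nonzero vectors in \<open>'k ^ 'v\<close>.
\<close>

type_synonym ('v, 'k) mpoly = "('v \<Rightarrow>\<^sub>0 nat) \<Rightarrow>\<^sub>0 'k"

definition eval :: "('v::finite, 'k::field) mpoly \<Rightarrow> 'k ^ 'v \<Rightarrow> 'k" where
  "eval f a = (\<Sum>e\<in>Poly_Mapping.keys f. Poly_Mapping.lookup f e *
                 (\<Prod>v\<in>UNIV. (a $ v) ^ Poly_Mapping.lookup e v))"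

definition forms :: "nat \<Rightarrow> ('v::finite, 'k::field) mpoly set" where
  "forms d = {f. \<forall>e\<in>Poly_Mapping.keys f. (\<Sum>v\<in>UNIV. Poly_Mapping.lookup e v) = d}"

text \<open>An ideal is a submodule of the ring, regarded as a module over itself.\<close>

definition ideal_gen :: "'a::comm_ring_1 set \<Rightarrow> 'a set" where
  "ideal_gen S = module.span (*) S"

definition ideal_pow :: "'a::comm_ring_1 set \<Rightarrow> nat \<Rightarrow> 'a set" where
  "ideal_pow I k = ideal_gen {(\<Prod>i<k. f i) | f. \<forall>i<k. f i \<in> I}"

text \<open>
  The generators are required to be homogeneous: over a finite field there are non-homogeneous
  polynomials vanishing on the whole line spanned by a vector that are not in the homogeneous
  ideal of the corresponding point.
\<close>

definition point_ideal :: "'k ^ 'v \<Rightarrow> ('v::finite, 'k::field) mpoly set" where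
  "point_ideal a = ideal_gen {f. (\<exists>e. f \<in> forms e) \<and> eval f a = 0}"

definition points_ideal :: "('k ^ 'v) set \<Rightarrow> ('v::finite, 'k::field) mpoly set" where
  "points_ideal Y = (\<Inter>a\<in>Y. point_ideal a)"

text \<open>
  \<open>quot_basis I d B\<close>: the residue classes of the elements of B are pairwise distinct and form a
  basis of the K-vector space [R/I]_d, the image of the forms of degree d in R/I. Here
  \<open>Poly_Mapping.single 0 c\<close> is the constant polynomial c.
\<close>

definition quot_basis ::
  "('v::finite, 'k::field) mpoly set \<Rightarrow> nat \<Rightarrow> ('v, 'k) mpoly set \<Rightarrow> bool" where
  "quot_basis I d B \<longleftrightarrow> finite B \<and> B \<subseteq> forms d \<and>
     (\<forall>c. (\<Sum>b\<in>B. Poly_Mapping.single 0 (c b) * b) \<in> I \<longrightarrow> (\<forall>b\<in>B. c b = 0)) \<and>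
     (\<forall>f\<in>forms d. \<exists>c. f - (\<Sum>b\<in>B. Poly_Mapping.single 0 (c b) * b) \<in> I)"

definition quot_dim :: "('v::finite, 'k::field) mpoly set \<Rightarrow> nat \<Rightarrow> nat" where
  "quot_dim I d = card (SOME B. quot_basis I d B)"

text \<open>
  A fat point scheme m_1 P_1 + ... + m_s P_s is given by s, the representing vectors
  \<open>P 1, \<dots>, P s\<close> and the multiplicities \<open>m 1, \<dots>, m s\<close>; values at other indices are irrelevant.
\<close>

definition same_point :: "'k ^ 'v \<Rightarrow> 'k::field ^ 'v::finite \<Rightarrow> bool" where
  "same_point a b \<longleftrightarrow> (\<exists>c. c \<noteq> 0 \<and> a = c *s b)"

definition fat_point_scheme ::
  "nat \<Rightarrow> (nat \<Rightarrow> 'k::field ^ 'v::finite) \<Rightarrow> (nat \<Rightarrow> nat) \<Rightarrow> bool" where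
  "fat_point_scheme s P m \<longleftrightarrow>
     (\<forall>i\<in>{1..s}. P i \<noteq> 0 \<and> m i > 0) \<and>
     (\<forall>i\<in>{1..s}. \<forall>j\<in>{1..s}. i \<noteq> j \<longrightarrow> \<not> same_point (P i) (P j))"

definition scheme_ideal ::
  "nat \<Rightarrow> (nat \<Rightarrow> 'k ^ 'v) \<Rightarrow> (nat \<Rightarrow> nat) \<Rightarrow> ('v::finite, 'k::field) mpoly set" where
  "scheme_ideal s P m = (\<Inter>i\<in>{1..s}. ideal_pow (point_ideal (P i)) (m i))"

definition scheme_deg ::
  "nat \<Rightarrow> (nat \<Rightarrow> 'k::field ^ 'v::finite) \<Rightarrow> (nat \<Rightarrow> nat) \<Rightarrow> nat" where
  "scheme_deg s P m = (let n = CARD('v) - 1 in \<Sum>i\<in>{1..s}. (m i + n - 1) choose n)"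

definition scheme_supp :: "nat \<Rightarrow> (nat \<Rightarrow> 'k::field ^ 'v::finite) \<Rightarrow> ('k ^ 'v) set" where
  "scheme_supp s P = P ` {1..s}"

text \<open>
  It suffices to consider degrees \<open>j \<ge> 0\<close>: in negative degrees R/I vanishes, while the degree of
  a nonempty scheme is positive.
\<close>

definition reg_index ::
  "nat \<Rightarrow> (nat \<Rightarrow> 'k::field ^ 'v::finite) \<Rightarrow> (nat \<Rightarrow> nat) \<Rightarrow> nat" where
  "reg_index s P m = (LEAST j. quot_dim (scheme_ideal s P m) j = scheme_deg s P m)"

end

theory Submission
  imports Defs "HOL-Library.Disjoint_Sets"
begin

text \<open>
  The ideal of the scheme is cut out, in each degree, by the coefficients of order less than \<open>m i\<close> in
  the local expansions at the points \<open>P i\<close>, and the number of these coefficients is the degree of the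
  scheme. So the regularity index is at most \<open>j\<close> as soon as they are independent functionals on the
  forms of degree \<open>j\<close>. Let \<open>t\<close> be the largest of the ceilings and \<open>j = d * t\<close>. Independence follows
  by triangularity if for each \<open>i\<close>, each \<open>k < m i\<close> and each monomial of degree \<open>k\<close> in local
  coordinates at \<open>P i\<close> there is a form of degree \<open>d * t\<close> that vanishes to order \<open>m j\<close> at every other
  point \<open>P j\<close> and whose expansion at \<open>P i\<close> starts with that monomial; these are the lemmas
  \<open>exists_form_with_leading_monomial\<close> and \<open>quot_dim_scheme_ideal\<close>.

  Such a form is found as a sum of products of \<open>t\<close> forms of degree \<open>d\<close>. Let \<open>A\<close> contain \<open>m j\<close> labels
  of each point \<open>P j\<close> other than \<open>P i\<close>, and let \<open>rk B\<close> be the number of conditions that the points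
  labelled by \<open>B\<close> impose on the forms of degree \<open>d\<close> vanishing at \<open>P i\<close>. By the choice of \<open>t\<close>, every
  nonempty \<open>B \<subseteq> A\<close> satisfies \<open>|B| + k \<le> t * rk B\<close>. If \<open>k = 0\<close>, this is the condition of Edmonds for
  a partition of \<open>A\<close> into \<open>t\<close> independent sets, and each of these sets lies on a form of degree \<open>d\<close>
  that is nonzero at \<open>P i\<close>; the product of the \<open>t\<close> forms is the required one.

  If \<open>k > 0\<close>, consider the forms of degree \<open>d\<close> that vanish at \<open>P i\<close> and at the points of some set
  \<open>J \<subseteq> A\<close>, with no repeated point, whose removal leaves a set of labels satisfying the inequality for
  \<open>t - 1\<close> and \<open>k - 1\<close>. The key fact, \<open>splitting_forms_span\<close>, is that they span the space of all forms
  of degree \<open>d\<close> that vanish at \<open>P i\<close>. It rests on a partition theorem, \<open>splitting_off_rank\<close>: otherwise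
  there is a functional \<open>q\<close> that kills them but not that whole space, and \<open>A\<close> can be split into a set
  \<open>J\<close> independent modulo \<open>P i\<close> and \<open>q\<close> and a set that satisfies the new inequality. Then \<open>J\<close> lies on
  a form vanishing at \<open>P i\<close> that \<open>q\<close> does not kill. Hence one local coordinate of the monomial,
  multiplied by a unit, is a combination of such forms, and induction provides the other \<open>t - 1\<close> factors
  for each summand.
\<close>

section \<open>Splitting a set between two submodular functions\<close>

definition submodular :: "('e set \<Rightarrow> int) \<Rightarrow> bool" where
  "submodular f \<longleftrightarrow> (\<forall>X Y. finite X \<longrightarrow> finite Y \<longrightarrow> f (X \<union> Y) + f (X \<inter> Y) \<le> f X + f Y)"

definition intersecting_submodular :: "('e set \<Rightarrow> int) \<Rightarrow> bool" where
  "intersecting_submodular g \<longleftrightarrow> (\<forall>X Y. finite X \<longrightarrow> finite Y \<longrightarrow> X \<inter> Y \<noteq> {} \<longrightarrow>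
     g (X \<union> Y) + g (X \<inter> Y) \<le> g X + g Y)"

lemma submodularD:
  "submodular f \<Longrightarrow> finite X \<Longrightarrow> finite Y \<Longrightarrow> f (X \<union> Y) + f (X \<inter> Y) \<le> f X + f Y"
  unfolding submodular_def by blast

lemma intersecting_submodularD:
  "intersecting_submodular g \<Longrightarrow> finite X \<Longrightarrow> finite Y \<Longrightarrow> X \<inter> Y \<noteq> {} \<Longrightarrow>
     g (X \<union> Y) + g (X \<inter> Y) \<le> g X + g Y"
  unfolding intersecting_submodular_def by blast

text \<open>
  Submodularity is what makes a greedy splitting work: start with every element offered to both
  sides and withdraw it from one of them. If both withdrawals of \<open>x\<close> were to violate the counting
  condition, on sets \<open>B\<close> and \<open>C\<close>, then \<open>B \<union> C\<close> or \<open>B \<inter> C - {x}\<close> would violate it already now.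
\<close>

lemma submodular_splitting_aux:
  fixes f1 f2 :: "'e set \<Rightarrow> int"
  assumes "submodular f1" "submodular f2" "f1 {} \<le> 0" "f2 {} \<le> 0"
    and "finite S1" "finite S2"
    and "\<And>B. B \<subseteq> S1 \<union> S2 \<Longrightarrow> int (card B) \<le> f1 (B \<inter> S1) + f2 (B \<inter> S2)"
  shows "\<exists>J\<subseteq>S1 \<union> S2. (\<forall>X\<subseteq>J. int (card X) \<le> f1 X) \<and>
           (\<forall>X\<subseteq>(S1 \<union> S2) - J. int (card X) \<le> f2 X)"
  using assms(5-7)
proof (induction "card (S1 \<inter> S2)" arbitrary: S1 S2)
  case 0
  then have disj: "S1 \<inter> S2 = {}" by auto
  have "int (card X) \<le> f1 X" if "X \<subseteq> S1" for X
  proof -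
    have "X \<inter> S1 = X" "X \<inter> S2 = {}" using that disj by auto
    then show ?thesis using 0(4)[of X] that assms(4) by (simp add: le_supI1)
  qed
  moreover have "int (card X) \<le> f2 X" if "X \<subseteq> (S1 \<union> S2) - S1" for X
  proof -
    have "X \<inter> S2 = X" "X \<inter> S1 = {}" using that disj by auto
    moreover have "X \<subseteq> S1 \<union> S2" using that by auto
    ultimately show ?thesis using 0(4)[of X] assms(3) by auto
  qed
  ultimately show ?case by (intro exI[of _ S1]) auto
next
  case (Suc c)
  then obtain x where x: "x \<in> S1" "x \<in> S2"
    by (metis card.empty disjoint_iff nat.distinct(1))
  have c: "c = card ((S1 - {x}) \<inter> S2)" "c = card (S1 \<inter> (S2 - {x}))"
  proof -
    have "(S1 - {x}) \<inter> S2 = (S1 \<inter> S2) - {x}" "S1 \<inter> (S2 - {x}) = (S1 \<inter> S2) - {x}" by auto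
    then show "c = card ((S1 - {x}) \<inter> S2)" "c = card (S1 \<inter> (S2 - {x}))"
      using Suc.hyps(2) x Suc.prems(1) by auto
  qed
  have U: "S1 - {x} \<union> S2 = S1 \<union> S2" "S1 \<union> (S2 - {x}) = S1 \<union> S2" using x by auto
  consider (a) "\<And>B. B \<subseteq> S1 \<union> S2 \<Longrightarrow> int (card B) \<le> f1 (B \<inter> (S1 - {x})) + f2 (B \<inter> S2)"
    | (b) "\<And>B. B \<subseteq> S1 \<union> S2 \<Longrightarrow> int (card B) \<le> f1 (B \<inter> S1) + f2 (B \<inter> (S2 - {x}))"
    | (c) B C where "B \<subseteq> S1 \<union> S2" "f1 (B \<inter> (S1 - {x})) + f2 (B \<inter> S2) < int (card B)"
        "C \<subseteq> S1 \<union> S2" "f1 (C \<inter> S1) + f2 (C \<inter> (S2 - {x})) < int (card C)"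
    by (meson not_le)
  then show ?case
  proof cases
    case a
    show ?thesis using Suc.hyps(1)[OF c(1)] Suc.prems a unfolding U by auto
  next
    case b
    show ?thesis using Suc.hyps(1)[OF c(2)] Suc.prems b unfolding U by auto
  next
    case c
    have xB: "x \<in> B"
    proof (rule ccontr)
      assume "x \<notin> B"
      then have "B \<inter> (S1 - {x}) = B \<inter> S1" by auto
      then show False using c(1,2) Suc.prems(3)[of B] by auto
    qed
    have xC: "x \<in> C"
    proof (rule ccontr)
      assume "x \<notin> C"
      then have "C \<inter> (S2 - {x}) = C \<inter> S2" by auto
      then show False using c(3,4) Suc.prems(3)[of C] by auto
    qed
    define D where "D = B \<inter> C - {x}"
    have fin: "finite B" "finite C" using c Suc.prems(1,2) finite_subset by blast+
    have "f1 (B \<inter> (S1 - {x}) \<union> C \<inter> S1) + f1 (B \<inter> (S1 - {x}) \<inter> (C \<inter> S1))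
        \<le> f1 (B \<inter> (S1 - {x})) + f1 (C \<inter> S1)"
      by (rule submodularD) (use assms fin in auto)
    moreover have "B \<inter> (S1 - {x}) \<union> C \<inter> S1 = (B \<union> C) \<inter> S1" using xC by auto
    moreover have "B \<inter> (S1 - {x}) \<inter> (C \<inter> S1) = D \<inter> S1" unfolding D_def by auto
    moreover have "f2 (B \<inter> S2 \<union> C \<inter> (S2 - {x})) + f2 (B \<inter> S2 \<inter> (C \<inter> (S2 - {x})))
        \<le> f2 (B \<inter> S2) + f2 (C \<inter> (S2 - {x}))"
      by (rule submodularD) (use assms fin in auto)
    moreover have "B \<inter> S2 \<union> C \<inter> (S2 - {x}) = (B \<union> C) \<inter> S2" using xB by auto
    moreover have "B \<inter> S2 \<inter> (C \<inter> (S2 - {x})) = D \<inter> S2" unfolding D_def by auto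
    moreover have "int (card (B \<union> C)) \<le> f1 ((B \<union> C) \<inter> S1) + f2 ((B \<union> C) \<inter> S2)"
      by (rule Suc.prems(3)) (use c in auto)
    moreover have "int (card D) \<le> f1 (D \<inter> S1) + f2 (D \<inter> S2)"
      by (rule Suc.prems(3)) (use c in \<open>auto simp: D_def\<close>)
    moreover have "card (B \<inter> C) = Suc (card D)"
      unfolding D_def using xB xC fin by (metis IntI card_Suc_Diff1 finite_Int)
    moreover have "card (B \<union> C) + card (B \<inter> C) = card B + card C"
      using card_Un_Int[OF fin] by simp
    ultimately show ?thesis using c(2,4) by auto
  qed
qed

lemma submodular_splitting:
  fixes f1 f2 :: "'e set \<Rightarrow> int"
  assumes "submodular f1" "submodular f2" "f1 {} \<le> 0" "f2 {} \<le> 0" "finite E"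
    and "\<And>B. B \<subseteq> E \<Longrightarrow> int (card B) \<le> f1 B + f2 B"
  obtains J where "J \<subseteq> E" "\<And>X. X \<subseteq> J \<Longrightarrow> int (card X) \<le> f1 X"
    "\<And>X. X \<subseteq> E - J \<Longrightarrow> int (card X) \<le> f2 X"
proof -
  have "\<exists>J\<subseteq>E \<union> E. (\<forall>X\<subseteq>J. int (card X) \<le> f1 X) \<and> (\<forall>X\<subseteq>(E \<union> E) - J. int (card X) \<le> f2 X)"
    by (rule submodular_splitting_aux[OF assms(1-5,5)]) (use assms(6) in \<open>simp add: inf.absorb1\<close>)
  then show ?thesis using that by auto
qed

text \<open>
  A function that is submodular on intersecting pairs only, such as a rank minus a constant, does
  not satisfy the hypothesis of the splitting lemma. Its minimum over partitions does; and as the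
  minimum is at most the original value on nonempty sets, an upper bound by it is the stronger one.
\<close>

definition partition_min :: "('e set \<Rightarrow> int) \<Rightarrow> 'e set \<Rightarrow> int" where
  "partition_min g B = Min {sum g Q | Q. partition_on B Q}"

lemma partition_min_le:
  assumes "finite B" "partition_on B Q" shows "partition_min g B \<le> sum g Q"
proof -
  have "finite {sum g Q | Q. partition_on B Q}"
    using finitely_many_partition_on[OF assms(1)] by simp
  then show ?thesis unfolding partition_min_def using assms(2) by (intro Min_le) auto
qed

lemma partition_min_attained:
  assumes "finite B" obtains Q where "partition_on B Q" "partition_min g B = sum g Q"
proof -
  have "finite {sum g Q | Q. partition_on B Q}"
    using finitely_many_partition_on[OF assms(1)] by simp
  moreover have "{sum g Q | Q. partition_on B Q} \<noteq> {}"
    using partition_on_singletons[of B] by blast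
  ultimately have "partition_min g B \<in> {sum g Q | Q. partition_on B Q}"
    unfolding partition_min_def by (rule Min_in)
  then show ?thesis using that by auto
qed

lemma partition_min_empty: "partition_min g {} = 0"
  by (simp add: partition_min_def partition_on_empty)

lemma partition_min_le_self:
  assumes "finite B" "B \<noteq> {}" shows "partition_min g B \<le> g B"
  using partition_min_le[OF assms(1) partition_on_space[OF assms(2)], of g] by simp

text \<open>
  The members of \<open>M\<close> are merged into \<open>C\<close> one at a time. As they are disjoint, each of them still
  meets the union built so far exactly in its intersection with \<open>C\<close>, which is nonempty.
\<close>

lemma absorb_family:
  assumes g: "intersecting_submodular g" and C: "finite C" and "finite M"
    and "\<And>D. D \<in> M \<Longrightarrow> finite D \<and> D \<inter> C \<noteq> {}" and "disjoint M"
  shows "g (C \<union> \<Union>M) + (\<Sum>D\<in>M. g (D \<inter> C)) \<le> g C + sum g M"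
  using assms(3-5)
proof (induction M)
  case empty then show ?case by simp
next
  case (insert D M)
  have disj: "D \<inter> \<Union>M = {}" using insert.prems(2) insert.hyps(2)
    by (metis Int_Union disjnt_Union2 disjnt_def pairwise_insert)
  have "g (C \<union> \<Union>M \<union> D) + g ((C \<union> \<Union>M) \<inter> D) \<le> g (C \<union> \<Union>M) + g D"
    by (rule intersecting_submodularD[OF g]) (use insert C in auto)
  moreover have "(C \<union> \<Union>M) \<inter> D = D \<inter> C" using disj by auto
  moreover have "C \<union> \<Union>M \<union> D = C \<union> \<Union>(insert D M)" by auto
  moreover have "g (C \<union> \<Union>M) + (\<Sum>D\<in>M. g (D \<inter> C)) \<le> g C + sum g M"
    using insert by (auto simp: pairwise_insert)
  ultimately show ?case using insert.hyps by simp
qed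

lemma uncross_one:
  assumes g: "intersecting_submodular g" and C: "finite C" "C \<noteq> {}"
    and B: "finite B" "partition_on B Q"
  obtains U I where "partition_on (B \<union> C) U" "partition_on (B \<inter> C) I"
    "sum g U + sum g I \<le> sum g Q + g C"
proof -
  define M where "M = {D \<in> Q. D \<inter> C \<noteq> {}}"
  define N where "N = Q - M"
  have finQ: "finite Q" using finite_elements B by blast
  have Q: "B = \<Union>Q" "disjoint Q" "{} \<notin> Q"
    using B(2) by (auto simp: partition_on_def)
  have NC: "D \<inter> (C \<union> \<Union>M) = {}" if "D \<in> N" for D
  proof -
    have "D \<in> Q" "D \<notin> M" using that N_def by auto
    moreover have "D \<inter> D' = {}" if "D' \<in> M" for D'
      using \<open>D \<in> Q\<close> \<open>D \<notin> M\<close> that Q(2) unfolding M_def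
      by (metis (no_types, lifting) disjointD mem_Collect_eq)
    ultimately show ?thesis unfolding M_def by blast
  qed
  have U: "partition_on (B \<union> C) (insert (C \<union> \<Union>M) N)"
  proof (rule partition_onI)
    show "\<Union> (insert (C \<union> \<Union>M) N) = B \<union> C" using Q(1) unfolding N_def M_def by auto
    show "disjnt p q" if "p \<in> insert (C \<union> \<Union>M) N" "q \<in> insert (C \<union> \<Union>M) N" "p \<noteq> q" for p q
    proof -
      have NN: "p \<inter> q = {}" if "p \<in> N" "q \<in> N" "p \<noteq> q" for p q
        using disjointD[OF Q(2), of p q] that unfolding N_def by auto
      show ?thesis
      proof (cases "p \<in> N \<and> q \<in> N")
        case True then show ?thesis using NN[of p q] that(3) by (simp add: disjnt_def)
      next
        case False
        then have "(p = C \<union> \<Union>M \<and> q \<in> N) \<or> (q = C \<union> \<Union>M \<and> p \<in> N)"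
          using that by auto
        then show ?thesis using NC unfolding disjnt_def by auto
      qed
    qed
    show "{} \<notin> insert (C \<union> \<Union>M) N" using C(2) Q(3) N_def by auto
  qed
  have inj: "inj_on (\<lambda>D. D \<inter> C) M"
  proof (rule inj_onI)
    fix D D' assume D: "D \<in> M" "D' \<in> M" "D \<inter> C = D' \<inter> C"
    then have "D \<inter> D' \<noteq> {}" unfolding M_def by auto
    then show "D = D'" using D Q(2) unfolding M_def by (metis (no_types, lifting) disjointD mem_Collect_eq)
  qed
  have I: "partition_on (B \<inter> C) ((\<lambda>D. D \<inter> C) ` M)"
  proof (rule partition_onI)
    show "\<Union> ((\<lambda>D. D \<inter> C) ` M) = B \<inter> C" using Q(1) unfolding M_def by auto
    show "disjnt p q" if "p \<in> (\<lambda>D. D \<inter> C) ` M" "q \<in> (\<lambda>D. D \<inter> C) ` M" "p \<noteq> q" for p q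
    proof -
      obtain D D' where D: "D \<in> M" "D' \<in> M" "p = D \<inter> C" "q = D' \<inter> C" using \<open>p \<in> _\<close> \<open>q \<in> _\<close> by auto
      then have "D \<inter> D' = {}" using \<open>p \<noteq> q\<close> Q(2) unfolding M_def
        by (metis (no_types, lifting) disjointD mem_Collect_eq)
      then show ?thesis using D unfolding disjnt_def by auto
    qed
    show "{} \<notin> (\<lambda>D. D \<inter> C) ` M" using M_def by auto
  qed
  have "g (C \<union> \<Union>M) + (\<Sum>D\<in>M. g (D \<inter> C)) \<le> g C + sum g M"
  proof (rule absorb_family[OF g C(1)])
    show "finite M" using finQ M_def by auto
    show "disjoint M" using Q(2) M_def by (simp add: pairwise_def)
    show "\<And>D. D \<in> M \<Longrightarrow> finite D \<and> D \<inter> C \<noteq> {}" 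
      using M_def Q(1) B(1) by (auto intro: finite_subset)
  qed
  moreover have "sum g Q = sum g M + sum g N"
    unfolding N_def using finQ M_def by (subst sum.subset_diff[of M]) auto
  moreover have "C \<union> \<Union>M \<notin> N" using NC C(2) by (metis Int_absorb Un_empty)
  moreover have "finite N" using finQ N_def by auto
  ultimately have "sum g (insert (C \<union> \<Union>M) N) + sum g ((\<lambda>D. D \<inter> C) ` M) \<le> sum g Q + g C"
    using inj by (simp add: sum.reindex)
  then show ?thesis using that U I by blast
qed

lemma uncross_families:
  assumes g: "intersecting_submodular g" and "finite R" and B: "finite B" "partition_on B Q"
    and "\<And>C. C \<in> R \<Longrightarrow> finite C \<and> C \<noteq> {}" and "disjoint R"
  shows "\<exists>U I. partition_on (B \<union> \<Union>R) U \<and> partition_on (B \<inter> \<Union>R) I \<and>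
    sum g U + sum g I \<le> sum g Q + sum g R"
  using assms(2,5-)
proof (induction R)
  case empty
  then show ?case using B by (intro exI[of _ Q] exI[of _ "{}"]) (auto simp: partition_on_empty)
next
  case (insert C R)
  have disj: "C \<inter> \<Union>R = {}" using insert.prems(2) insert.hyps(2)
    by (metis Int_Union disjnt_Union2 disjnt_def pairwise_insert)
  obtain U1 I1 where 1: "partition_on (B \<union> \<Union>R) U1" "partition_on (B \<inter> \<Union>R) I1"
    "sum g U1 + sum g I1 \<le> sum g Q + sum g R"
    using insert.IH insert.prems by (auto simp: pairwise_insert)
  obtain U I where 2: "partition_on (B \<union> \<Union>R \<union> C) U" "partition_on ((B \<union> \<Union>R) \<inter> C) I"
    "sum g U + sum g I \<le> sum g U1 + g C"
    by (rule uncross_one[OF g _ _ _ 1(1), of C]) (use insert B in auto)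
  have e: "(B \<union> \<Union>R) \<inter> C = B \<inter> C" using disj by auto
  have d: "p \<inter> q = {}" if "p \<in> I1" "q \<in> I" for p q
    using that 1(2) 2(2) disj unfolding e partition_on_def by blast
  have I: "partition_on (B \<inter> \<Union>(insert C R)) (I1 \<union> I)"
  proof (rule partition_onI)
    show "\<Union> (I1 \<union> I) = B \<inter> \<Union> (insert C R)"
      using 1(2) 2(2) unfolding e partition_on_def by auto
    show "disjnt p q" if "p \<in> I1 \<union> I" "q \<in> I1 \<union> I" "p \<noteq> q" for p q
      using that d[of p q] d[of q p] disjointD[OF partition_onD2[OF 1(2)], of p q]
        disjointD[OF partition_onD2[OF 2(2)], of p q] unfolding disjnt_def by auto
    show "{} \<notin> I1 \<union> I" using 1(2) 2(2) by (auto simp: partition_on_def)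
  qed
  have "I1 \<inter> I = {}"
  proof (rule ccontr)
    assume "I1 \<inter> I \<noteq> {}"
    then obtain p where "p \<in> I1" "p \<in> I" by auto
    then have "p = {}" using d[of p p] by auto
    then show False using \<open>p \<in> I1\<close> 1(2) by (auto simp: partition_on_def)
  qed
  moreover have "finite I1" "finite I"
    using finite_elements[OF _ 1(2)] finite_elements[OF _ 2(2)] B(1) insert.prems insert.hyps by auto
  ultimately have "sum g (I1 \<union> I) = sum g I1 + sum g I" by (simp add: sum.union_disjoint)
  moreover have "B \<union> \<Union>R \<union> C = B \<union> \<Union>(insert C R)" by auto
  ultimately show ?case using I 1 2 insert.hyps
    by (intro exI[of _ U] exI[of _ "I1 \<union> I"]) auto
qed

text \<open>
  Optimal partitions of \<open>X\<close> and \<open>Y\<close> are uncrossed by absorbing the parts of the second partition one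
  after the other into the first; this yields partitions of \<open>X \<union> Y\<close> and \<open>X \<inter> Y\<close> without increasing
  the total value.
\<close>

lemma submodular_partition_min:
  assumes g: "intersecting_submodular g" shows "submodular (partition_min g)"
  unfolding submodular_def
proof (intro allI impI)
  fix X Y :: "'a set" assume fin: "finite X" "finite Y"
  obtain Q where Q: "partition_on X Q" "partition_min g X = sum g Q"
    using partition_min_attained[OF fin(1)] .
  obtain R where R: "partition_on Y R" "partition_min g Y = sum g R"
    using partition_min_attained[OF fin(2)] .
  have Y: "\<Union>R = Y" using R(1) by (auto simp: partition_on_def)
  have "\<exists>U I. partition_on (X \<union> \<Union>R) U \<and> partition_on (X \<inter> \<Union>R) I \<and>
    sum g U + sum g I \<le> sum g Q + sum g R"
    by (rule uncross_families[OF g _ fin(1) Q(1)])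
      (use R fin finite_elements in \<open>auto simp: partition_on_def intro: finite_subset\<close>)
  then obtain U I where UI: "partition_on (X \<union> Y) U" "partition_on (X \<inter> Y) I"
    "sum g U + sum g I \<le> sum g Q + sum g R" unfolding Y by blast
  have "partition_min g (X \<union> Y) \<le> sum g U" using partition_min_le[OF _ UI(1)] fin by auto
  moreover have "partition_min g (X \<inter> Y) \<le> sum g I" using partition_min_le[OF _ UI(2)] fin by auto
  ultimately show "partition_min g (X \<union> Y) + partition_min g (X \<inter> Y) \<le> partition_min g X + partition_min g Y"
    using UI(3) Q R by linarith
qed

text \<open>
  This is the partition result behind the whole proof. The function \<open>rk'\<close> stands for the rank \<open>rk\<close>
  after one further contraction, which is smaller by at most one; \<open>J\<close> is independent for \<open>rk'\<close>, and its removal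
  costs one unit of \<open>t\<close> but also gives back one unit of \<open>k\<close>. The second property says that \<open>E - J\<close> is
  independent with respect to \<open>(t - 1) * rk - (k - 1)\<close>, which is submodular on intersecting pairs
  only. So the counting condition has to be checked on all partitions of a set \<open>B\<close>, and the bound is
  available both for the parts and for \<open>B\<close>.
\<close>

lemma splitting_off_rank:
  fixes rk rk' :: "'e set \<Rightarrow> int" and t k :: int
  assumes "submodular rk" "submodular rk'" "rk {} \<le> 0" "rk' {} \<le> 0"
    and drop: "\<And>X. finite X \<Longrightarrow> rk X - 1 \<le> rk' X" "\<And>X. finite X \<Longrightarrow> 0 \<le> rk' X"
    and "finite E" "1 \<le> k" "k \<le> t"
    and bound: "\<And>B. B \<subseteq> E \<Longrightarrow> B \<noteq> {} \<Longrightarrow> int (card B) + k \<le> t * rk B"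
  obtains J where "J \<subseteq> E" "\<And>X. X \<subseteq> J \<Longrightarrow> int (card X) \<le> rk' X"
    "\<And>B. B \<subseteq> E - J \<Longrightarrow> B \<noteq> {} \<Longrightarrow> int (card B) + (k - 1) \<le> (t - 1) * rk B"
proof -
  define g where "g B = (t - 1) * rk B - (k - 1)" for B
  have g: "intersecting_submodular g"
    unfolding intersecting_submodular_def
  proof (intro allI impI)
    fix X Y :: "'e set" assume "finite X" "finite Y"
    then have "rk (X \<union> Y) + rk (X \<inter> Y) \<le> rk X + rk Y" using submodularD[OF assms(1)] by blast
    then have "(t - 1) * (rk (X \<union> Y) + rk (X \<inter> Y)) \<le> (t - 1) * (rk X + rk Y)"
      using assms by (intro mult_left_mono) auto
    then show "g (X \<union> Y) + g (X \<inter> Y) \<le> g X + g Y"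
      unfolding g_def by (simp add: algebra_simps)
  qed
  have hall: "int (card B) \<le> rk' B + partition_min g B" if "B \<subseteq> E" for B
  proof (cases "B = {}")
    case True then show ?thesis using drop(2)[of B] by (simp add: partition_min_empty)
  next
    case False
    have finB: "finite B" using that assms(7) finite_subset by blast
    obtain Q where Q: "partition_on B Q" "partition_min g B = sum g Q"
      using partition_min_attained[OF finB] .
    have finQ: "finite Q" using finite_elements[OF finB Q(1)] .
    have QE: "D \<subseteq> B" "D \<noteq> {}" if "D \<in> Q" for D using that Q(1) by (auto simp: partition_on_def)
    define S where "S = sum rk Q"
    define p where "p = int (card Q)"
    have sg: "sum g Q = (t - 1) * S - p * (k - 1)"
      unfolding g_def S_def p_def by (simp add: sum_subtractf sum_distrib_left)
    have p1: "p \<ge> 1"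
    proof -
      have "Q \<noteq> {}" using False Q(1) by (auto simp: partition_on_def)
      then show ?thesis unfolding p_def using finQ by (simp add: Suc_le_eq card_gt_0_iff)
    qed
    have b1: "int (card B) \<le> t * S - p * k"
    proof -
      have "card B = (\<Sum>D\<in>Q. card D)"
        using Q(1) finB by (metis card_Union_disjoint finite_subset QE(1) partition_onD1 partition_onD2)
      then have "int (card B) = (\<Sum>D\<in>Q. int (card D))" by simp
      also have "\<dots> \<le> (\<Sum>D\<in>Q. t * rk D - k)"
      proof (rule sum_mono)
        fix D assume "D \<in> Q"
        show "int (card D) \<le> t * rk D - k" using bound[of D] QE[OF \<open>D \<in> Q\<close>] \<open>B \<subseteq> E\<close>
          by (metis add_le_imp_le_diff subset_trans)
      qed
      also have "\<dots> = t * S - p * k"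
        unfolding S_def p_def by (simp add: sum_subtractf sum_distrib_left)
      finally show ?thesis .
    qed
    have b2: "int (card B) \<le> t * rk B - k" using bound[OF that False] by simp
    have d: "rk B - 1 \<le> rk' B" using drop finB by blast
    \<comment> \<open>If the parts overlap little in rank, the bounds on the parts suffice; otherwise the bound
      on \<open>B\<close> itself does.\<close>
    show ?thesis
    proof (cases "S - p \<le> rk B - 1")
      case True
      have "t * S - p * k = (t - 1) * S - p * (k - 1) + (S - p)" by (simp add: algebra_simps)
      then show ?thesis using b1 True d sg Q(2) by linarith
    next
      case False
      have "(p - 1) * (k - 1) \<le> p * (t - 1)" using p1 assms(8,9) by (intro mult_mono) auto
      also have "\<dots> \<le> (S - rk B) * (t - 1)" using False assms(8,9) by (intro mult_right_mono) auto
      finally have "t * rk B - k \<le> (t - 1) * S - p * (k - 1) + (rk B - 1)" by (simp add: algebra_simps)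
      then show ?thesis using b2 d sg Q(2) by linarith
    qed
  qed
  obtain J where J: "J \<subseteq> E" "\<And>X. X \<subseteq> J \<Longrightarrow> int (card X) \<le> rk' X"
    "\<And>X. X \<subseteq> E - J \<Longrightarrow> int (card X) \<le> partition_min g X"
    using submodular_splitting[OF assms(2) submodular_partition_min[OF g] assms(4) _ assms(7) hall]
    by (auto simp: partition_min_empty)
  show ?thesis
  proof (rule that[OF J(1,2)])
    fix B assume B: "B \<subseteq> E - J" "B \<noteq> {}"
    then have "finite B" using assms(7) finite_subset by blast
    then show "int (card B) + (k - 1) \<le> (t - 1) * rk B"
      using J(3)[OF B(1)] partition_min_le_self[OF _ B(2), of g] unfolding g_def by linarith
  qed
qed

section \<open>Ranks of families of linear functionals\<close>

text \<open>
  A finite set \<open>S\<close> of linear functionals on a space \<open>L\<close> of finite dimension has a rank, the number of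
  independent conditions that it imposes on \<open>L\<close>. Measuring it as the codimension of the common kernel
  makes the conditions imposed by points on forms, and the dimensions of the quotients \<open>[R/I]\<^sub>d\<close>,
  instances of the same notion.
\<close>

definition annihilator :: "'b set \<Rightarrow> ('b \<Rightarrow> 'a::zero) set \<Rightarrow> 'b set" where
  "annihilator L S = {f \<in> L. \<forall>\<phi>\<in>S. \<phi> f = 0}"

lemma annihilator_insert: "annihilator L (insert \<phi> S) = {f \<in> annihilator L S. \<phi> f = 0}"
  by (auto simp: annihilator_def)

lemma annihilator_antimono: "S \<subseteq> T \<Longrightarrow> annihilator L T \<subseteq> annihilator L S"
  by (auto simp: annihilator_def)

lemma annihilator_subset: "annihilator L S \<subseteq> L"
  by (auto simp: annihilator_def)

locale finitely_spanned_subspace = vector_space +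
  fixes L G :: "'b set"
  assumes subspace_L: "subspace L" and finite_G: "finite G" and L_le_span: "L \<subseteq> span G"
begin

definition functional :: "('b \<Rightarrow> 'a) \<Rightarrow> bool" where
  "functional \<phi> \<longleftrightarrow> (\<forall>x y. \<phi> (x + y) = \<phi> x + \<phi> y) \<and> (\<forall>c x. \<phi> (scale c x) = c * \<phi> x)"

definition codim :: "('b \<Rightarrow> 'a) set \<Rightarrow> nat" where
  "codim S = dim L - dim (annihilator L S)"

lemma functional_zero: "functional \<phi> \<Longrightarrow> \<phi> 0 = 0"
  unfolding functional_def by (metis add_cancel_right_right)

lemma functional_minus: "functional \<phi> \<Longrightarrow> \<phi> (x - y) = \<phi> x - \<phi> y"
  unfolding functional_def by (metis add_diff_cancel diff_add_cancel)

lemma subspace_annihilator: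
  assumes "\<And>\<phi>. \<phi> \<in> S \<Longrightarrow> functional \<phi>"
  shows "subspace (annihilator L S)"
proof (rule subspaceI)
  show "0 \<in> annihilator L S"
    using subspace_0[OF subspace_L] functional_zero[OF assms] by (simp add: annihilator_def)
next
  fix x y assume xy: "x \<in> annihilator L S" "y \<in> annihilator L S"
  have "\<phi> (x + y) = 0" if "\<phi> \<in> S" for \<phi>
  proof -
    have "\<phi> x = 0" "\<phi> y = 0" using xy that by (auto simp: annihilator_def)
    then show ?thesis using assms[OF that] by (simp add: functional_def)
  qed
  then show "x + y \<in> annihilator L S"
    using xy subspace_add[OF subspace_L] by (simp add: annihilator_def)
next
  fix c x assume x: "x \<in> annihilator L S"
  have "\<phi> (scale c x) = 0" if "\<phi> \<in> S" for \<phi>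
    using assms[OF that] x that by (simp add: functional_def annihilator_def)
  then show "scale c x \<in> annihilator L S"
    using x subspace_scale[OF subspace_L] by (simp add: annihilator_def)
qed

lemma separating_functional:
  assumes "subspace U" "g \<notin> U"
  obtains \<phi> where "functional \<phi>" "\<phi> g = 1" "\<And>u. u \<in> U \<Longrightarrow> \<phi> u = 0"
proof -
  obtain B where B: "B \<subseteq> U" "independent B" "U \<subseteq> span B" by (rule basis_exists)
  have "span B = U" using B assms(1) by (simp add: span_subspace)
  then have "g \<notin> span B" using assms(2) by simp
  then have "independent (insert g B)" using B(2) by (rule independent_insertI)
  then obtain C where C: "insert g B \<subseteq> C" "independent C" "UNIV \<subseteq> span C"
    using maximal_independent_subset_extend[of "insert g B" UNIV] by auto
  have gB: "g \<notin> B" using \<open>g \<notin> span B\<close> span_base by blast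
  have C': "v \<in> span C" for v using C(3) by auto
  show ?thesis
  proof (rule that[of "\<lambda>v. representation C v g"])
    show "functional (\<lambda>v. representation C v g)"
      unfolding functional_def using C(2) C' by (simp add: representation_add representation_scale)
    show "representation C g g = 1" using C(1,2) by (simp add: representation_basis)
    fix u assume "u \<in> U"
    then have "representation C u = representation B u"
      using representation_extend[OF C(2), of u B] B(3) C(1) by auto
    moreover have "representation B u g = 0" using gB representation_ne_zero by blast
    ultimately show "representation C u g = 0" by simp
  qed
qed


lemma finite_independent: "independent B \<Longrightarrow> B \<subseteq> L \<Longrightarrow> finite B"
  using independent_span_bound[OF finite_G] L_le_span by blast

lemma dim_mono_in_L:
  assumes "W \<subseteq> W'" "W' \<subseteq> L" shows "dim W \<le> dim W'"
proof -
  obtain C where C: "C \<subseteq> W'" "independent C" "W' \<subseteq> span C" "card C = dim W'" by (rule basis_exists)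
  have "finite C" using C assms finite_independent by blast
  then have "dim W \<le> card C" by (intro dim_le_card) (use assms C in auto)
  then show ?thesis using C by simp
qed

lemma dim_kernel:
  assumes W: "subspace W" "W \<subseteq> L" and "functional \<phi>" "w \<in> W" "\<phi> w \<noteq> 0"
  shows "dim W = Suc (dim {f \<in> W. \<phi> f = 0})"
proof -
  define K where "K = {f \<in> W. \<phi> f = 0}"
  have K: "subspace K"
    using W(1) functional_zero[OF assms(3)] assms(3) unfolding K_def subspace_def functional_def by auto
  obtain B where B: "B \<subseteq> K" "independent B" "K \<subseteq> span B" "card B = dim K" by (rule basis_exists)
  have "finite B" using B finite_independent W(2) K_def by blast
  have "span B = K" using B K by (simp add: span_subspace)
  then have w: "w \<notin> span B" using assms(5) K_def by auto
  have "W \<subseteq> span (insert w B)"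
  proof
    fix f assume "f \<in> W"
    then have "f - scale (\<phi> f / \<phi> w) w \<in> K"
      using W(1) assms(3-5) functional_minus[OF assms(3)]
      unfolding K_def by (auto simp: subspace_diff subspace_scale functional_def)
    then show "f \<in> span (insert w B)" using B(3) span_breakdown_eq by blast
  qed
  then have "card (insert w B) = dim W"
    using B(1,2) w assms(4) independent_insertI K_def by (intro basis_card_eq_dim) auto
  then show ?thesis using w \<open>finite B\<close> B(4) span_base K_def by (metis card_insert_disjoint)
qed

text \<open>
  This is the rank-nullity formula for one functional on the common kernel of the others. The bounds
  by cardinality, submodularity and the independence criterion below all reduce to this case.
\<close>

lemma codim_insert:
  assumes "\<And>\<psi>. \<psi> \<in> insert \<phi> S \<Longrightarrow> functional \<psi>"
  shows "codim (insert \<phi> S) = codim S + (if \<exists>f\<in>annihilator L S. \<phi> f \<noteq> 0 then 1 else 0)"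
proof (cases "\<exists>f\<in>annihilator L S. \<phi> f \<noteq> 0")
  case True
  then obtain f where f: "f \<in> annihilator L S" "\<phi> f \<noteq> 0" by blast
  have "dim (annihilator L S) = Suc (dim (annihilator L (insert \<phi> S)))"
    unfolding annihilator_insert
    by (rule dim_kernel[of _ _ f]) (use assms f subspace_annihilator annihilator_subset[of L S] in auto)
  moreover have "dim (annihilator L S) \<le> dim L"
    using dim_mono_in_L[OF annihilator_subset] by auto
  ultimately show ?thesis using True unfolding codim_def by auto
next
  case False
  then have "annihilator L (insert \<phi> S) = annihilator L S"
    unfolding annihilator_insert by auto
  then show ?thesis using False unfolding codim_def by simp
qed

lemma codim_empty: "codim {} = 0"
  by (simp add: codim_def annihilator_def)

lemma codim_mono: "S \<subseteq> T \<Longrightarrow> codim S \<le> codim T"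
  unfolding codim_def
  by (intro diff_le_mono2 dim_mono_in_L annihilator_antimono annihilator_subset)

lemma codim_insert_le:
  assumes "\<And>\<psi>. \<psi> \<in> insert \<phi> S \<Longrightarrow> functional \<psi>"
  shows "codim (insert \<phi> S) \<le> Suc (codim S)"
  using codim_insert[OF assms] by auto

lemma codim_union_le_card:
  assumes "finite T" "\<And>\<psi>. \<psi> \<in> S \<union> T \<Longrightarrow> functional \<psi>"
  shows "codim (S \<union> T) \<le> codim S + card T"
  using assms
proof (induction T)
  case empty then show ?case by simp
next
  case (insert \<phi> T)
  have "codim (insert \<phi> (S \<union> T)) \<le> Suc (codim (S \<union> T))"
    by (rule codim_insert_le) (use insert in auto)
  then show ?case using insert by auto
qed

lemma codim_le_card:
  assumes "finite T" "\<And>\<psi>. \<psi> \<in> T \<Longrightarrow> functional \<psi>"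
  shows "codim T \<le> card T"
  using codim_union_le_card[of T "{}"] assms by (simp add: codim_empty)

text \<open>
  A functional that vanishes on a common kernel also vanishes on each smaller one, so the gain from
  adding functionals decreases when the set grows. This is submodularity in its local form.
\<close>

lemma codim_diminishing:
  assumes "finite D" "X \<subseteq> Y" "\<And>\<psi>. \<psi> \<in> Y \<union> D \<Longrightarrow> functional \<psi>"
  shows "codim (Y \<union> D) + codim X \<le> codim (X \<union> D) + codim Y"
  using assms(1,3)
proof (induction D)
  case empty then show ?case by simp
next
  case (insert \<phi> D)
  have "codim (insert \<phi> (Y \<union> D)) = codim (Y \<union> D) + (if \<exists>f\<in>annihilator L (Y \<union> D). \<phi> f \<noteq> 0 then 1 else 0)"
    by (rule codim_insert) (use insert in auto)
  moreover have "codim (insert \<phi> (X \<union> D)) = codim (X \<union> D) + (if \<exists>f\<in>annihilator L (X \<union> D). \<phi> f \<noteq> 0 then 1 else 0)"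
    by (rule codim_insert) (use insert assms(2) in auto)
  moreover have "annihilator L (Y \<union> D) \<subseteq> annihilator L (X \<union> D)"
    by (rule annihilator_antimono) (use assms(2) in auto)
  ultimately show ?case using insert by (auto split: if_splits)
qed

lemma codim_submodular:
  assumes "finite T" "\<And>\<psi>. \<psi> \<in> S \<union> T \<Longrightarrow> functional \<psi>"
  shows "codim (S \<union> T) + codim (S \<inter> T) \<le> codim S + codim T"
proof -
  have "codim (S \<union> T) + codim (S \<inter> T) \<le> codim (S \<inter> T \<union> T) + codim S"
    by (rule codim_diminishing) (use assms in auto)
  moreover have "S \<inter> T \<union> T = T" by auto
  ultimately show ?thesis by simp
qed

lemma codim_increase_witness:
  assumes "\<And>\<psi>. \<psi> \<in> insert \<phi> S \<Longrightarrow> functional \<psi>" "codim S < codim (insert \<phi> S)"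
  obtains f where "f \<in> annihilator L S" "\<phi> f \<noteq> 0"
  using codim_insert[OF assms(1)] assms(2) by (auto split: if_splits)

text \<open>
  The functionals are added in the order of increasing height; each of them raises the rank because
  of its witness, which is only required to be in the kernel of the functionals that come earlier.
\<close>

lemma codim_triangular:
  fixes h :: "'i \<Rightarrow> nat" and \<Phi> :: "'i \<Rightarrow> 'b \<Rightarrow> 'a"
  assumes "finite I" "\<And>i. i \<in> I \<Longrightarrow> functional (\<Phi> i)"
    and "\<And>i. i \<in> I \<Longrightarrow> \<exists>f\<in>L. \<Phi> i f \<noteq> 0 \<and> (\<forall>j\<in>I. j \<noteq> i \<longrightarrow> h j \<le> h i \<longrightarrow> \<Phi> j f = 0)"
  shows "codim (\<Phi> ` I) = card I"
  using assms
proof (induction I rule: finite_ranking_induct[where f = h])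
  case empty then show ?case by (simp add: codim_empty)
next
  case (insert i I)
  have IH: "codim (\<Phi> ` I) = card I"
  proof (rule insert.IH)
    show "functional (\<Phi> k)" if "k \<in> I" for k
      using insert.prems(1)[of k] that by simp
    show "\<exists>f\<in>L. \<Phi> k f \<noteq> 0 \<and> (\<forall>j\<in>I. j \<noteq> k \<longrightarrow> h j \<le> h k \<longrightarrow> \<Phi> j f = 0)" if "k \<in> I" for k
      using insert.prems(2)[of k] that by fastforce
  qed
  show ?case
  proof (cases "i \<in> I")
    case True then show ?thesis using IH by (simp add: insert_absorb)
  next
    case False
    have "\<exists>f\<in>L. \<Phi> i f \<noteq> 0 \<and> (\<forall>j\<in>insert i I. j \<noteq> i \<longrightarrow> h j \<le> h i \<longrightarrow> \<Phi> j f = 0)"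
      by (rule insert.prems(2)) simp
    then obtain f where f: "f \<in> L" "\<Phi> i f \<noteq> 0"
      "\<forall>j\<in>insert i I. j \<noteq> i \<longrightarrow> h j \<le> h i \<longrightarrow> \<Phi> j f = 0" by blast
    have "\<Phi> j f = 0" if "j \<in> I" for j using f(3) insert.hyps(2)[OF that] that False by auto
    then have "f \<in> annihilator L (\<Phi> ` I)" using f(1) unfolding annihilator_def by auto
    then have "\<exists>f\<in>annihilator L (\<Phi> ` I). \<Phi> i f \<noteq> 0" using f(2) by blast
    moreover have "\<And>\<psi>. \<psi> \<in> insert (\<Phi> i) (\<Phi> ` I) \<Longrightarrow> functional \<psi>"
      using insert.prems(1) by blast
    ultimately have "codim (insert (\<Phi> i) (\<Phi> ` I)) = codim (\<Phi> ` I) + 1"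
      using codim_insert[of "\<Phi> i" "\<Phi> ` I"] by simp
    then show ?thesis using False insert.hyps(1) IH by simp
  qed
qed

text \<open>
  A basis of \<open>L\<close> modulo \<open>I\<close> and a basis of \<open>L \<inter> I\<close> together form a basis of \<open>L\<close>, so all
  bases of the quotient have the same size.
\<close>

lemma quotient_basis_card:
  assumes I: "subspace I" and B: "finite B" "B \<subseteq> L"
    and ind: "\<And>c. (\<Sum>b\<in>B. scale (c b) b) \<in> I \<Longrightarrow> \<forall>b\<in>B. c b = 0"
    and spn: "\<And>f. f \<in> L \<Longrightarrow> \<exists>c. f - (\<Sum>b\<in>B. scale (c b) b) \<in> I"
  shows "card B = dim L - dim (L \<inter> I)"
proof -
  obtain C where C: "C \<subseteq> L \<inter> I" "independent C" "L \<inter> I \<subseteq> span C" "card C = dim (L \<inter> I)"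
    by (rule basis_exists)
  have finC: "finite C" using C finite_independent by blast
  have disj: "B \<inter> C = {}"
  proof (rule ccontr)
    assume "B \<inter> C \<noteq> {}"
    then obtain b where b: "b \<in> B" "b \<in> C" by auto
    have "(\<Sum>x\<in>B. scale (if x = b then 1 else 0) x) = (\<Sum>x\<in>B. if x = b then x else 0)"
      by (rule sum.cong) auto
    also have "\<dots> = b" using b B(1) by simp
    finally show False using ind[of "\<lambda>x. if x = b then 1 else 0"] b C(1)
      by (metis Int_iff subsetD zero_neq_one)
  qed
  have "independent (B \<union> C)"
  proof (rule independent_if_scalars_zero)
    show "finite (B \<union> C)" using B finC by simp
    fix u x assume u: "(\<Sum>x\<in>B \<union> C. scale (u x) x) = 0" and x: "x \<in> B \<union> C"
    have e: "(\<Sum>x\<in>B. scale (u x) x) + (\<Sum>x\<in>C. scale (u x) x) = 0"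
      using u disj B(1) finC by (simp add: sum.union_disjoint)
    have "(\<Sum>x\<in>C. scale (u x) x) \<in> I"
      using C(1) I by (intro subspace_sum subspace_scale) auto
    then have "- (\<Sum>x\<in>C. scale (u x) x) \<in> I" using I subspace_neg by blast
    then have "(\<Sum>x\<in>B. scale (u x) x) \<in> I" using eq_neg_iff_add_eq_0[of "\<Sum>x\<in>B. scale (u x) x" "\<Sum>x\<in>C. scale (u x) x"] e by simp
    then have uB: "\<forall>b\<in>B. u b = 0" by (rule ind)
    then have "(\<Sum>x\<in>C. scale (u x) x) = 0" using e by simp
    then have "\<forall>c\<in>C. u c = 0" using independentD[OF C(2) finC order_refl] by blast
    then show "u x = 0" using uB x by auto
  qed
  moreover have "L \<subseteq> span (B \<union> C)"
  proof
    fix f assume f: "f \<in> L"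
    obtain c where c: "f - (\<Sum>b\<in>B. scale (c b) b) \<in> I" using spn[OF f] by blast
    have s: "(\<Sum>b\<in>B. scale (c b) b) \<in> L" "(\<Sum>b\<in>B. scale (c b) b) \<in> span (B \<union> C)"
    proof -
      show "(\<Sum>b\<in>B. scale (c b) b) \<in> L"
        by (intro subspace_sum subspace_scale) (use B(2) subspace_L in auto)
      show "(\<Sum>b\<in>B. scale (c b) b) \<in> span (B \<union> C)"
        by (intro span_sum span_scale span_base) auto
    qed
    have "f - (\<Sum>b\<in>B. scale (c b) b) \<in> L \<inter> I" using c f s(1) subspace_L subspace_diff by blast
    then have "f - (\<Sum>b\<in>B. scale (c b) b) \<in> span (B \<union> C)" using C(3) span_mono[of C "B \<union> C"] by blast
    then show "f \<in> span (B \<union> C)" using s(2) span_add by fastforce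
  qed
  ultimately have "card (B \<union> C) = dim L" using B C by (intro basis_card_eq_dim) auto
  then show ?thesis using card_Un_disjoint[OF B(1) finC disj] C(4) by simp
qed

lemma quotient_basis_exists:
  assumes I: "subspace I"
  shows "\<exists>B. finite B \<and> B \<subseteq> L \<and>
    (\<forall>c. (\<Sum>b\<in>B. scale (c b) b) \<in> I \<longrightarrow> (\<forall>b\<in>B. c b = 0)) \<and>
    (\<forall>f\<in>L. \<exists>c. f - (\<Sum>b\<in>B. scale (c b) b) \<in> I)"
proof -
  obtain C where C: "C \<subseteq> L \<inter> I" "independent C" "L \<inter> I \<subseteq> span C" "card C = dim (L \<inter> I)"
    by (rule basis_exists)
  obtain D where D: "C \<subseteq> D" "D \<subseteq> L" "independent D" "L \<subseteq> span D"
    using maximal_independent_subset_extend[of C L] C by blast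
  have finD: "finite D" using D finite_independent by blast
  then have finC: "finite C" using D finite_subset by blast
  show ?thesis
  proof (intro exI[of _ "D - C"] conjI allI ballI impI)
    show "finite (D - C)" "D - C \<subseteq> L" using finD D by auto
  next
    fix c assume c: "(\<Sum>b\<in>D - C. scale (c b) b) \<in> I"
    have "(\<Sum>b\<in>D - C. scale (c b) b) \<in> L"
      by (intro subspace_sum subspace_scale) (use D(2) subspace_L in auto)
    then have "(\<Sum>b\<in>D - C. scale (c b) b) \<in> span C" using c C(3) by blast
    then obtain e where e: "(\<Sum>b\<in>D - C. scale (c b) b) = (\<Sum>b\<in>C. scale (e b) b)"
      using span_finite[OF finC] by auto
    define u where "u b = (if b \<in> C then - e b else c b)" for b
    have "(\<Sum>b\<in>D. scale (u b) b) = (\<Sum>b\<in>D - C. scale (u b) b) + (\<Sum>b\<in>C. scale (u b) b)"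
      using sum.subset_diff[OF D(1) finD] .
    also have "\<dots> = (\<Sum>b\<in>D - C. scale (c b) b) + (\<Sum>b\<in>C. - scale (e b) b)"
      by (simp add: u_def)
    also have "\<dots> = 0" using e by (simp add: sum_negf)
    finally have "\<forall>b\<in>D. u b = 0" using independentD[OF D(3) finD order_refl] by blast
    then show "c b = 0" if "b \<in> D - C" for b using that unfolding u_def by (metis DiffE)
  next
    fix f assume "f \<in> L"
    then obtain u where u: "f = (\<Sum>b\<in>D. scale (u b) b)" using D(4) span_finite[OF finD] by auto
    have "(\<Sum>b\<in>C. scale (u b) b) \<in> I" using C(1) I by (intro subspace_sum subspace_scale) auto
    moreover have "f - (\<Sum>b\<in>D - C. scale (u b) b) = (\<Sum>b\<in>C. scale (u b) b)"
      unfolding u using sum.subset_diff[OF D(1) finD, of "\<lambda>b. scale (u b) b"] by simp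
    ultimately show "\<exists>c. f - (\<Sum>b\<in>D - C. scale (c b) b) \<in> I" by metis
  qed
qed

end

section \<open>Polynomials and substitutions\<close>

text \<open>
  Evaluations and substitutions are both instances of the universal property of the polynomial ring.
\<close>

definition mpoly_hom :: "('k::zero \<Rightarrow> 'b::comm_ring_1) \<Rightarrow> ('v \<Rightarrow> 'b) \<Rightarrow> (('v::finite \<Rightarrow>\<^sub>0 nat) \<Rightarrow>\<^sub>0 'k) \<Rightarrow> 'b" where
  "mpoly_hom c s f = (\<Sum>e\<in>Poly_Mapping.keys f. c (Poly_Mapping.lookup f e) *
     (\<Prod>v\<in>UNIV. s v ^ Poly_Mapping.lookup e v))"

lemma poly_mapping_as_sum:
  "f = (\<Sum>e\<in>Poly_Mapping.keys f. Poly_Mapping.single e (Poly_Mapping.lookup f e))"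
  by (rule poly_mapping_eqI) (simp add: lookup_sum lookup_single when_def in_keys_iff sum.delta)

locale coefficient_hom =
  fixes c :: "'k::comm_ring_1 \<Rightarrow> 'b::comm_ring_1"
  assumes c_zero: "c 0 = 0" and c_one: "c 1 = 1"
    and c_add: "c (x + y) = c x + c y" and c_mult: "c (x * y) = c x * c y"
begin

lemma hom_superset:
  assumes "finite A" "Poly_Mapping.keys f \<subseteq> A"
  shows "mpoly_hom c s f = (\<Sum>e\<in>A. c (Poly_Mapping.lookup f e) *
     (\<Prod>v\<in>UNIV. s v ^ Poly_Mapping.lookup e v))"
  unfolding mpoly_hom_def
  by (rule sum.mono_neutral_left[OF assms]) (simp add: in_keys_iff c_zero)

lemma hom_zero: "mpoly_hom c s 0 = 0"
  by (simp add: mpoly_hom_def)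

lemma hom_add: "mpoly_hom c s (f + g) = mpoly_hom c s f + mpoly_hom c s g"
proof -
  define A where "A = Poly_Mapping.keys f \<union> Poly_Mapping.keys g"
  have "finite A" "Poly_Mapping.keys f \<subseteq> A" "Poly_Mapping.keys g \<subseteq> A" "Poly_Mapping.keys (f + g) \<subseteq> A"
    unfolding A_def using keys_add[of f g] by auto
  then show ?thesis
    by (simp add: hom_superset[of A] lookup_add c_add algebra_simps sum.distrib)
qed

lemma hom_minus: "mpoly_hom c s (f - g) = mpoly_hom c s f - mpoly_hom c s g"
  using hom_add[of s "f - g" g] by simp

lemma hom_sum: "mpoly_hom c s (\<Sum>i\<in>A. f i) = (\<Sum>i\<in>A. mpoly_hom c s (f i))"
  by (induction A rule: infinite_finite_induct) (simp_all add: hom_zero hom_add)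

lemma hom_single:
  "mpoly_hom c s (Poly_Mapping.single e x) = c x * (\<Prod>v\<in>UNIV. s v ^ Poly_Mapping.lookup e v)"
  using hom_superset[of "{e}" "Poly_Mapping.single e x" s] by simp

lemma hom_const: "mpoly_hom c s (Poly_Mapping.single 0 x) = c x"
  by (simp add: hom_single)

lemma hom_one: "mpoly_hom c s 1 = 1"
  using hom_const[of s 1] by (simp add: c_one)

lemma hom_mult: "mpoly_hom c s (f * g) = mpoly_hom c s f * mpoly_hom c s g"
proof -
  have 1: "mpoly_hom c s (Poly_Mapping.single e x * Poly_Mapping.single e' y) =
      mpoly_hom c s (Poly_Mapping.single e x) * mpoly_hom c s (Poly_Mapping.single e' y)" for e e' x y
    by (simp add: mult_single hom_single c_mult lookup_add power_add prod.distrib algebra_simps)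
  let ?S = "\<lambda>f. \<Sum>e\<in>Poly_Mapping.keys f. Poly_Mapping.single e (Poly_Mapping.lookup f e)"
  have "mpoly_hom c s (?S f * ?S g) = mpoly_hom c s (?S f) * mpoly_hom c s (?S g)"
    by (simp only: sum_product hom_sum 1)
  then show ?thesis by (simp flip: poly_mapping_as_sum)
qed

lemma hom_power: "mpoly_hom c s (f ^ n) = mpoly_hom c s f ^ n"
  by (induction n) (simp_all add: hom_one hom_mult)

lemma hom_prod: "mpoly_hom c s (\<Prod>i\<in>A. f i) = (\<Prod>i\<in>A. mpoly_hom c s (f i))"
  by (induction A rule: infinite_finite_induct) (simp_all add: hom_one hom_mult)

end

abbreviation const :: "'k::comm_ring_1 \<Rightarrow> ('v \<Rightarrow>\<^sub>0 nat) \<Rightarrow>\<^sub>0 'k" where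
  "const \<equiv> Poly_Mapping.single 0"

abbreviation monomial :: "('v \<Rightarrow>\<^sub>0 nat) \<Rightarrow> ('v \<Rightarrow>\<^sub>0 nat) \<Rightarrow>\<^sub>0 'k::comm_ring_1" where
  "monomial e \<equiv> Poly_Mapping.single e 1"

definition variable :: "'v \<Rightarrow> ('v \<Rightarrow>\<^sub>0 nat) \<Rightarrow>\<^sub>0 'k::comm_ring_1" where
  "variable v = monomial (Poly_Mapping.single v 1)"

interpretation evaluation: coefficient_hom "\<lambda>x::'k::comm_ring_1. x"
  by unfold_locales auto

interpretation substitution: coefficient_hom "const :: 'k::comm_ring_1 \<Rightarrow> ('v \<Rightarrow>\<^sub>0 nat) \<Rightarrow>\<^sub>0 'k"
  by unfold_locales (auto simp: single_add mult_single)

lemma eval_eq_hom: "eval f a = mpoly_hom (\<lambda>x. x) (($) a) f"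
  by (simp add: eval_def mpoly_hom_def)

lemma eval_add: "eval (f + g) a = eval f a + eval g a"
  and eval_zero: "eval 0 a = 0"
  and eval_minus: "eval (f - g) a = eval f a - eval g a"
  and eval_mult: "eval (f * g) a = eval f a * eval g a"
  and eval_power: "eval (f ^ n) a = eval f a ^ n"
  and eval_const: "eval (const x) a = x"
  by (simp_all add: eval_eq_hom evaluation.hom_add evaluation.hom_zero evaluation.hom_minus
    evaluation.hom_mult evaluation.hom_power evaluation.hom_const)

lemma eval_prod: "eval (\<Prod>i\<in>A. F i) a = (\<Prod>i\<in>A. eval (F i) a)"
  and eval_sum: "eval (\<Sum>i\<in>A. F i) a = (\<Sum>i\<in>A. eval (F i) a)"
  by (simp_all add: eval_eq_hom evaluation.hom_prod evaluation.hom_sum)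

abbreviation subst :: "('v \<Rightarrow> ('v::finite, 'k::field) mpoly) \<Rightarrow> ('v, 'k) mpoly \<Rightarrow> ('v, 'k) mpoly" where
  "subst \<equiv> mpoly_hom const"

lemma prod_power_single:
  fixes s :: "'v::finite \<Rightarrow> 'b::comm_monoid_mult"
  shows "(\<Prod>v\<in>UNIV. s v ^ Poly_Mapping.lookup (Poly_Mapping.single w n) v) = s w ^ n"
proof -
  have "(\<Prod>v\<in>UNIV. s v ^ Poly_Mapping.lookup (Poly_Mapping.single w n) v) =
      (\<Prod>v\<in>UNIV. if v = w then s w ^ n else 1)"
    by (rule prod.cong) (auto simp: lookup_single when_def)
  then show ?thesis by simp
qed

lemma eval_variable: "eval (variable v) a = a $ v"
  by (simp add: eval_eq_hom variable_def evaluation.hom_single prod_power_single)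

lemma subst_variable: "subst s (variable v) = s v"
  by (simp add: variable_def substitution.hom_single prod_power_single)

lemma variable_power: "variable v ^ n = (monomial (Poly_Mapping.single v n) :: (_, 'k::comm_ring_1) mpoly)"
  by (induction n) (simp_all add: variable_def mult_single flip: single_add)

lemma monomial_prod:
  "finite A \<Longrightarrow> (\<Prod>v\<in>A. monomial (h v)) = (monomial (\<Sum>v\<in>A. h v) :: (_, 'k::comm_ring_1) mpoly)"
  by (induction A rule: finite_induct) (simp_all add: mult_single)

lemma exponent_as_sum: "(\<Sum>v\<in>UNIV. Poly_Mapping.single v (Poly_Mapping.lookup e v)) = (e :: 'v::finite \<Rightarrow>\<^sub>0 nat)"
  by (rule poly_mapping_eqI) (simp add: lookup_sum lookup_single when_def)

lemma monomial_as_prod: "(\<Prod>v\<in>UNIV. variable v ^ Poly_Mapping.lookup e v) = (monomial e :: ('v::finite, 'k::field) mpoly)"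
  by (simp add: variable_power monomial_prod exponent_as_sum)

lemma subst_variables: "subst variable f = f"
proof -
  have "subst variable f = (\<Sum>e\<in>Poly_Mapping.keys f. Poly_Mapping.single e (Poly_Mapping.lookup f e))"
    unfolding mpoly_hom_def monomial_as_prod by (simp add: mult_single)
  then show ?thesis by (simp flip: poly_mapping_as_sum)
qed

lemma subst_subst: "subst r (subst s f) = subst (\<lambda>v. subst r (s v)) f"
proof -
  have "subst r (subst s f) = (\<Sum>e\<in>Poly_Mapping.keys f. subst r (const (Poly_Mapping.lookup f e) *
     (\<Prod>v\<in>UNIV. s v ^ Poly_Mapping.lookup e v)))"
    unfolding mpoly_hom_def[of const s] by (rule substitution.hom_sum)
  then show ?thesis
    by (simp add: mpoly_hom_def[of const "\<lambda>v. subst r (s v)"] substitution.hom_mult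
      substitution.hom_const substitution.hom_prod substitution.hom_power)
qed

lemma eval_subst: "eval (subst s f) a = eval f (\<chi> v. eval (s v) a)"
proof -
  have "eval (subst s f) a = (\<Sum>e\<in>Poly_Mapping.keys f. eval (const (Poly_Mapping.lookup f e) *
     (\<Prod>v\<in>UNIV. s v ^ Poly_Mapping.lookup e v)) a)"
    unfolding mpoly_hom_def[of const s] by (rule eval_sum)
  then show ?thesis
    by (simp add: eval_def[of f] eval_mult eval_const eval_prod eval_power)
qed

section \<open>Forms and the order of vanishing at a coordinate point\<close>

definition total_degree :: "('v::finite \<Rightarrow>\<^sub>0 nat) \<Rightarrow> nat" where
  "total_degree e = (\<Sum>v\<in>UNIV. Poly_Mapping.lookup e v)"

text \<open>
  At the coordinate point where only \<open>x\<^sub>p\<close> is nonzero, \<open>x\<^sub>p\<close> is a unit and the other variables are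
  local coordinates. So the degree of a monomial in these other variables is its order of vanishing.
\<close>

definition off_degree :: "'v \<Rightarrow> ('v::finite \<Rightarrow>\<^sub>0 nat) \<Rightarrow> nat" where
  "off_degree p e = (\<Sum>v\<in>UNIV - {p}. Poly_Mapping.lookup e v)"

definition order_ge :: "'v \<Rightarrow> nat \<Rightarrow> ('v::finite, 'k::field) mpoly set" where
  "order_ge p m = {f. \<forall>e\<in>Poly_Mapping.keys f. m \<le> off_degree p e}"

lemma forms_alt: "forms d = {f. \<forall>e\<in>Poly_Mapping.keys f. total_degree e = d}"
  by (simp add: forms_def total_degree_def)

lemma total_degree_add: "total_degree (e + e') = total_degree e + total_degree e'"
  by (simp add: total_degree_def lookup_add sum.distrib)

lemma off_degree_add: "off_degree p (e + e') = off_degree p e + off_degree p e'"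
  by (simp add: off_degree_def lookup_add sum.distrib)

lemma total_degree_single: "total_degree (Poly_Mapping.single v n) = n"
  by (simp add: total_degree_def lookup_single when_def)

lemma off_degree_single: "off_degree p (Poly_Mapping.single v n) = (if v = p then 0 else n)"
  by (simp add: off_degree_def lookup_single when_def)

lemma total_degree_split: "total_degree e = Poly_Mapping.lookup e p + off_degree p e"
  unfolding total_degree_def off_degree_def by (rule sum.remove) auto

lemma total_degree_0 [simp]: "total_degree 0 = 0"
  by (simp add: total_degree_def)

lemma off_degree_0 [simp]: "off_degree p 0 = 0"
  by (simp add: off_degree_def)

lemma off_degree_eq_0:
  assumes "off_degree p e = 0" shows "e = Poly_Mapping.single p (total_degree e)"
proof (rule poly_mapping_eqI)
  fix v
  show "Poly_Mapping.lookup e v = Poly_Mapping.lookup (Poly_Mapping.single p (total_degree e)) v"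
    using assms total_degree_split[of e p] by (auto simp: off_degree_def lookup_single when_def)
qed

lemma keys_mult_weight:
  assumes "e \<in> Poly_Mapping.keys (f * g)"
  obtains a b where "e = a + b" "a \<in> Poly_Mapping.keys f" "b \<in> Poly_Mapping.keys g"
  using assms keys_mult[of f g] by auto

lemma forms_mult: "f \<in> forms d \<Longrightarrow> g \<in> forms d' \<Longrightarrow> f * g \<in> forms (d + d')"
  unfolding forms_alt by (auto elim!: keys_mult_weight simp: total_degree_add)

lemma forms_add: "f \<in> forms d \<Longrightarrow> g \<in> forms d \<Longrightarrow> f + g \<in> forms d"
  unfolding forms_alt using keys_add[of f g] by blast

lemma forms_zero: "0 \<in> forms d"
  by (simp add: forms_alt)

lemma forms_const: "const x \<in> forms 0"
  by (simp add: forms_alt)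

lemma forms_one: "1 \<in> forms 0"
  using forms_const[of 1] by simp

lemma forms_scale: "f \<in> forms d \<Longrightarrow> const x * f \<in> forms d"
  using forms_mult[OF forms_const] by fastforce

lemma forms_diff: "f \<in> forms d \<Longrightarrow> g \<in> forms d \<Longrightarrow> f - g \<in> forms d"
  unfolding forms_alt using keys_diff[of f g] by blast

lemma forms_sum: "(\<And>i. i \<in> A \<Longrightarrow> f i \<in> forms d) \<Longrightarrow> (\<Sum>i\<in>A. f i) \<in> forms d"
  by (induction A rule: infinite_finite_induct) (auto simp: forms_zero forms_add)

lemma forms_power: "f \<in> forms d \<Longrightarrow> f ^ n \<in> forms (n * d)"
  by (induction n) (auto simp: forms_one forms_mult)

lemma forms_prod:
  "finite A \<Longrightarrow> (\<And>i. i \<in> A \<Longrightarrow> f i \<in> forms (h i)) \<Longrightarrow> (\<Prod>i\<in>A. f i) \<in> forms (\<Sum>i\<in>A. h i)"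
  by (induction A rule: finite_induct) (auto simp: forms_one forms_mult)

lemma forms_monomial: "monomial e \<in> forms (total_degree e)"
  by (simp add: forms_alt)

lemma forms_variable: "variable v \<in> forms (Suc 0)"
  by (simp add: forms_alt variable_def total_degree_single)

lemma forms_subst:
  assumes "\<And>v. s v \<in> forms 1" "f \<in> forms d" shows "subst s f \<in> forms d"
  unfolding mpoly_hom_def
proof (rule forms_sum, rule forms_scale)
  fix e assume "e \<in> Poly_Mapping.keys f"
  then have "d = (\<Sum>v\<in>UNIV. Poly_Mapping.lookup e v * 1)" using assms(2) by (simp add: forms_def)
  then show "(\<Prod>v\<in>UNIV. s v ^ Poly_Mapping.lookup e v) \<in> forms d"
    by (simp only:, intro forms_prod forms_power assms) auto
qed

lemma order_ge_mult: "f \<in> order_ge p m \<Longrightarrow> g \<in> order_ge p n \<Longrightarrow> f * g \<in> order_ge p (m + n)"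
  unfolding order_ge_def by (auto elim!: keys_mult_weight simp: off_degree_add add_mono)

lemma order_ge_0: "f \<in> order_ge p 0"
  unfolding order_ge_def by auto

lemma order_ge_scale: "f \<in> order_ge p m \<Longrightarrow> g * f \<in> order_ge p m"
  using order_ge_mult[OF order_ge_0] by fastforce

lemma order_ge_add: "f \<in> order_ge p m \<Longrightarrow> g \<in> order_ge p m \<Longrightarrow> f + g \<in> order_ge p m"
  unfolding order_ge_def using keys_add[of f g] by blast

lemma order_ge_zero: "0 \<in> order_ge p m"
  unfolding order_ge_def by auto

lemma order_ge_lookup: "f \<in> order_ge p m \<Longrightarrow> off_degree p e < m \<Longrightarrow> Poly_Mapping.lookup f e = 0"
  unfolding order_ge_def by (metis (mono_tags, lifting) in_keys_iff linorder_not_le mem_Collect_eq)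

text \<open>
  At a coordinate point all monomials of a form vanish except the pure power of that variable.
\<close>

lemma lookup_pivot_power:
  assumes "f \<in> forms d"
  shows "Poly_Mapping.lookup f (Poly_Mapping.single p d) = eval f (axis p 1)"
proof -
  have "(\<Prod>v\<in>UNIV. axis p (1::'b) $ v ^ Poly_Mapping.lookup e v) = (if e = Poly_Mapping.single p d then 1 else 0)"
    if "total_degree e = d" for e :: "'a \<Rightarrow>\<^sub>0 nat"
  proof (cases "off_degree p e = 0")
    case True
    then have "e = Poly_Mapping.single p d" using off_degree_eq_0 that by blast
    then show ?thesis by (simp add: prod_power_single axis_def)
  next
    case False
    then have "e \<noteq> Poly_Mapping.single p d" by (auto simp: off_degree_single)
    moreover obtain v where "v \<noteq> p" "Poly_Mapping.lookup e v \<noteq> 0"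
      using False unfolding off_degree_def by (metis DiffD2 insertI1 sum.neutral)
    then have "(\<Prod>v\<in>UNIV. axis p (1::'b) $ v ^ Poly_Mapping.lookup e v) = 0"
      by (intro prod_zero) (auto simp: axis_def intro!: bexI[of _ v])
    ultimately show ?thesis by simp
  qed
  then have "eval f (axis p 1) = (\<Sum>e\<in>Poly_Mapping.keys f. Poly_Mapping.lookup f e * (if e = Poly_Mapping.single p d then 1 else 0))"
    unfolding eval_def using assms by (intro sum.cong) (auto simp: forms_alt)
  also have "\<dots> = Poly_Mapping.lookup f (Poly_Mapping.single p d)"
    by (simp add: if_distrib in_keys_iff cong: if_cong)
  finally show ?thesis by simp
qed

section \<open>Powers of the ideal of a point in local coordinates\<close>

text \<open>
  A linear change of coordinates that moves the point \<open>a\<close> to a coordinate point turns membership in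
  the powers of its ideal into a condition on exponents. As the new basis one can take \<open>a\<close> itself
  together with all unit vectors except the one at a position where \<open>a\<close> is nonzero.
\<close>

definition pivot :: "'k::field ^ 'v::finite \<Rightarrow> 'v" where
  "pivot a = (SOME p. a $ p \<noteq> 0)"

lemma pivot_nonzero: "a \<noteq> 0 \<Longrightarrow> a $ pivot a \<noteq> 0"
  unfolding pivot_def by (metis (mono_tags, lifting) someI_ex vec_eq_iff zero_index)

definition to_local :: "'k::field ^ 'v::finite \<Rightarrow> 'v \<Rightarrow> ('v, 'k) mpoly" where
  "to_local a v = const (a $ v) * variable (pivot a) + (if v = pivot a then 0 else variable v)"

definition from_local :: "'k::field ^ 'v::finite \<Rightarrow> 'v \<Rightarrow> ('v, 'k) mpoly" where
  "from_local a v = (if v = pivot a then const (1 / a $ pivot a) * variable (pivot a)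
     else variable v - const (a $ v / a $ pivot a) * variable (pivot a))"

definition localize :: "'k::field ^ 'v::finite \<Rightarrow> ('v, 'k) mpoly \<Rightarrow> ('v, 'k) mpoly" where
  "localize a = subst (to_local a)"

definition delocalize :: "'k::field ^ 'v::finite \<Rightarrow> ('v, 'k) mpoly \<Rightarrow> ('v, 'k) mpoly" where
  "delocalize a = subst (from_local a)"

lemmas subst_ring_simps = substitution.hom_add substitution.hom_minus substitution.hom_mult
  substitution.hom_const substitution.hom_zero subst_variable

lemma const_mult: "const x * (const y * f) = const (x * y) * f"
  by (simp add: mult_single flip: mult.assoc)

lemma delocalize_localize: "a \<noteq> 0 \<Longrightarrow> delocalize a (localize a f) = f"
proof -
  assume "a \<noteq> 0"
  then have "subst (from_local a) (to_local a v) = variable v" for v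
    using pivot_nonzero[of a]
    by (simp add: to_local_def subst_ring_simps from_local_def const_mult)
  then show ?thesis by (simp add: localize_def delocalize_def subst_subst subst_variables)
qed

lemma localize_delocalize: "a \<noteq> 0 \<Longrightarrow> localize a (delocalize a f) = f"
proof -
  assume "a \<noteq> 0"
  then have "subst (to_local a) (from_local a v) = variable v" for v
    using pivot_nonzero[of a]
    by (simp add: to_local_def subst_ring_simps from_local_def const_mult)
  then show ?thesis by (simp add: localize_def delocalize_def subst_subst subst_variables)
qed

lemma localize_ring:
  "localize a (f + g) = localize a f + localize a g" "localize a (f - g) = localize a f - localize a g"
  "localize a (f * g) = localize a f * localize a g" "localize a (const x) = const x"
  "localize a 0 = 0" "localize a 1 = 1"
  by (simp_all add: localize_def subst_ring_simps substitution.hom_one)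

lemma forms_localize: "f \<in> forms d \<Longrightarrow> localize a f \<in> forms d"
  unfolding localize_def
proof (rule forms_subst)
  show "to_local a v \<in> forms 1" for v
    unfolding to_local_def by (auto intro!: forms_add forms_scale forms_variable simp: forms_zero)
qed

lemma forms_from_local: "from_local a v \<in> forms 1"
  unfolding from_local_def by (auto intro!: forms_diff forms_scale forms_variable)

lemma forms_delocalize: "f \<in> forms d \<Longrightarrow> delocalize a f \<in> forms d"
  unfolding delocalize_def by (intro forms_subst forms_from_local)

lemma eval_localize: "eval (localize a f) (axis (pivot a) 1) = eval f a"
proof -
  have "eval (to_local a v) (axis (pivot a) 1) = a $ v" for v
    by (simp add: to_local_def eval_add eval_mult eval_const eval_variable eval_zero axis_def)
  then show ?thesis by (simp add: localize_def eval_subst)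
qed

lemma lookup_localize_pivot:
  "f \<in> forms d \<Longrightarrow> Poly_Mapping.lookup (localize a f) (Poly_Mapping.single (pivot a) d) = eval f a"
  using lookup_pivot_power[OF forms_localize] eval_localize by metis

lemma forms_order_ge_1:
  assumes "f \<in> forms d" "Poly_Mapping.lookup f (Poly_Mapping.single p d) = 0"
  shows "f \<in> order_ge p 1"
  unfolding order_ge_def
proof (intro CollectI ballI, rule ccontr)
  fix e assume e: "e \<in> Poly_Mapping.keys f" "\<not> 1 \<le> off_degree p e"
  have "total_degree e = d" using assms(1) e(1) by (auto simp: forms_alt)
  then have "e = Poly_Mapping.single p d" using off_degree_eq_0[of p e] e(2) by simp
  then show False using e(1) assms(2) by (simp add: in_keys_iff)
qed

lemma localize_order_ge_1:
  assumes "f \<in> forms d" "eval f a = 0"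
  shows "localize a f \<in> order_ge (pivot a) 1"
  using forms_order_ge_1[OF forms_localize[OF assms(1)]] lookup_localize_pivot[OF assms(1)] assms(2)
  by metis

lemma module_ring: "module ((*) :: 'a::comm_ring_1 \<Rightarrow> 'a \<Rightarrow> 'a)"
  by unfold_locales (auto simp: algebra_simps)

lemma ideal_gen_base: "f \<in> S \<Longrightarrow> f \<in> ideal_gen S"
  unfolding ideal_gen_def by (rule module.span_base[OF module_ring])

lemma ideal_gen_add: "f \<in> ideal_gen S \<Longrightarrow> g \<in> ideal_gen S \<Longrightarrow> f + g \<in> ideal_gen S"
  unfolding ideal_gen_def by (rule module.span_add[OF module_ring])

lemma ideal_gen_mult: "f \<in> ideal_gen S \<Longrightarrow> g * f \<in> ideal_gen S"
  unfolding ideal_gen_def by (rule module.span_scale[OF module_ring])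

lemma ideal_gen_zero: "0 \<in> ideal_gen S"
  unfolding ideal_gen_def by (rule module.span_zero[OF module_ring])

lemma ideal_gen_sum: "(\<And>i. i \<in> A \<Longrightarrow> F i \<in> ideal_gen S) \<Longrightarrow> (\<Sum>i\<in>A. F i) \<in> ideal_gen S"
  unfolding ideal_gen_def by (rule module.span_sum[OF module_ring])

lemma ideal_gen_induct [consumes 1, case_names zero step]:
  assumes "f \<in> ideal_gen S" "P 0" "\<And>c x y. x \<in> S \<Longrightarrow> P y \<Longrightarrow> P (c * x + y)"
  shows "P f"
  by (rule module.span_induct_alt[OF module_ring assms(1)[unfolded ideal_gen_def]])
    (use assms(2,3) in auto)

lemma localize_point_ideal:
  assumes "f \<in> point_ideal a" shows "localize a f \<in> order_ge (pivot a) 1"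
  using assms unfolding point_ideal_def
proof (induction rule: ideal_gen_induct)
  case zero then show ?case by (simp add: localize_ring order_ge_zero)
next
  case (step c x y)
  then show ?case using localize_order_ge_1
    by (auto simp: localize_ring intro!: order_ge_add order_ge_scale)
qed

lemma localize_ideal_pow:
  assumes "f \<in> ideal_pow (point_ideal a) m" shows "localize a f \<in> order_ge (pivot a) m"
  using assms unfolding ideal_pow_def
proof (induction rule: ideal_gen_induct)
  case zero then show ?case by (simp add: localize_ring order_ge_zero)
next
  case (step c x y)
  then obtain f where f: "x = (\<Prod>i<m. f i)" "\<forall>i<m. f i \<in> point_ideal a" by auto
  have "localize a (\<Prod>i<k. f i) \<in> order_ge (pivot a) k" if "k \<le> m" for k
    using that
  proof (induction k)
    case 0 then show ?case by (simp add: order_ge_0)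
  next
    case (Suc k)
    then have "localize a (\<Prod>i<k. f i) * localize a (f k) \<in> order_ge (pivot a) (k + 1)"
      using f(2) by (intro order_ge_mult localize_point_ideal) auto
    then show ?case by (simp add: localize_ring)
  qed
  then have "localize a x \<in> order_ge (pivot a) m" using f(1) by simp
  then show ?case using step by (auto simp: localize_ring intro!: order_ge_add order_ge_scale)
qed

lemma ideal_pow_mult:
  assumes "f \<in> I" "g \<in> ideal_pow I m" shows "f * g \<in> ideal_pow I (Suc m)"
  using assms(2) unfolding ideal_pow_def
proof (induction rule: ideal_gen_induct)
  case zero then show ?case by (simp add: ideal_gen_zero)
next
  case (step c x y)
  then obtain h where h: "x = (\<Prod>i<m. h i)" "\<forall>i<m. h i \<in> I" by auto
  let ?h = "\<lambda>i. if i = m then f else h i"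
  have "(\<Prod>i<Suc m. ?h i) = f * x" unfolding h(1) by (simp add: mult.commute)
  moreover have "\<forall>i<Suc m. ?h i \<in> I" using h(2) assms(1) by auto
  ultimately have "f * x \<in> {(\<Prod>i<Suc m. h i) | h. \<forall>i<Suc m. h i \<in> I}"
    by (intro CollectI exI[of _ ?h] conjI) simp_all
  then have "f * x \<in> ideal_gen {(\<Prod>i<Suc m. h i) | h. \<forall>i<Suc m. h i \<in> I}"
    by (rule ideal_gen_base)
  then have "c * (f * x) + f * y \<in> ideal_gen {(\<Prod>i<Suc m. h i) | h. \<forall>i<Suc m. h i \<in> I}"
    using ideal_gen_add[OF ideal_gen_mult step(2)] by simp
  moreover have "f * (c * x + y) = c * (f * x) + f * y" by (simp only: algebra_simps)
  ultimately show ?case by (simp only:)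
qed

lemma ideal_pow_scale: "g \<in> ideal_pow I m \<Longrightarrow> f * g \<in> ideal_pow I m"
  unfolding ideal_pow_def by (rule ideal_gen_mult)

lemma ideal_pow_0: "f \<in> ideal_pow I 0"
proof -
  have "1 \<in> ideal_pow I 0" unfolding ideal_pow_def by (rule ideal_gen_base) auto
  then show ?thesis using ideal_pow_scale[of 1 I 0 f] by simp
qed

lemma ideal_pow_power_mult:
  assumes "f \<in> I" "g \<in> ideal_pow I m" shows "f ^ k * g \<in> ideal_pow I (k + m)"
proof (induction k)
  case 0 then show ?case using assms(2) by simp
next
  case (Suc k) show ?case using ideal_pow_mult[OF assms(1) Suc] by (simp only: power_Suc mult.assoc add_Suc)
qed

lemma ideal_pow_antimono:
  assumes "\<And>f g. f \<in> I \<Longrightarrow> g * f \<in> I"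
  shows "f \<in> ideal_pow I (m + k) \<Longrightarrow> f \<in> ideal_pow I m"
proof (induction k)
  case 0 then show ?case by simp
next
  case (Suc k)
  have "f \<in> ideal_pow I (m + k)"
    using Suc.prems unfolding ideal_pow_def
  proof (induction rule: ideal_gen_induct)
    case zero then show ?case by (simp add: ideal_gen_zero)
  next
    case (step c x y)
    then obtain h where h: "x = (\<Prod>i<Suc (m + k). h i)" "\<forall>i<Suc (m + k). h i \<in> I" by auto
    have "x = h (m + k) * (\<Prod>i<m + k. h i)" unfolding h(1) by (simp add: mult.commute)
    then have "c * x + y = (c * h (m + k)) * (\<Prod>i<m + k. h i) + y" by (simp add: mult.assoc)
    moreover have "(\<Prod>i<m + k. h i) \<in> {(\<Prod>i<m + k. h i) | h. \<forall>i<m + k. h i \<in> I}"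
      using h(2) by (intro CollectI exI[of _ h]) simp
    then have "(c * h (m + k)) * (\<Prod>i<m + k. h i) + y \<in> ideal_gen {(\<Prod>i<m + k. h i) | h. \<forall>i<m + k. h i \<in> I}"
      by (rule ideal_gen_add[OF ideal_gen_mult[OF ideal_gen_base] step(2)])
    ultimately show ?case by simp
  qed
  then show ?case using Suc.IH by blast
qed

lemma from_local_in_point_ideal:
  assumes "a \<noteq> 0" "v \<noteq> pivot a" shows "from_local a v \<in> point_ideal a"
proof -
  have "eval (from_local a v) a = 0"
    using assms pivot_nonzero[OF assms(1)]
    by (simp add: from_local_def eval_minus eval_mult eval_const eval_variable)
  then show ?thesis unfolding point_ideal_def using forms_from_local by (intro ideal_gen_base) auto
qed

text \<open>
  Returning to the old coordinates replaces each variable except the pivot by a linear form that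
  vanishes at \<open>a\<close>, hence a monomial of off-degree at least \<open>m\<close> by a multiple of a product of \<open>m\<close>
  elements of the ideal of \<open>a\<close>.
\<close>

lemma ideal_pow_localize:
  assumes "a \<noteq> 0" "localize a f \<in> order_ge (pivot a) m"
  shows "f \<in> ideal_pow (point_ideal a) m"
proof -
  let ?I = "point_ideal a"
  have prod: "(\<Prod>v\<in>A. from_local a v ^ n v) * g \<in> ideal_pow ?I (\<Sum>v\<in>A. n v)"
    if "finite A" "pivot a \<notin> A" for A g and n :: "_ \<Rightarrow> nat"
    using that
  proof (induction A rule: finite_induct)
    case empty then show ?case by (simp add: ideal_pow_0)
  next
    case (insert v A)
    then have "from_local a v ^ n v * ((\<Prod>v\<in>A. from_local a v ^ n v) * g)
        \<in> ideal_pow ?I (n v + (\<Sum>v\<in>A. n v))"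
      by (intro ideal_pow_power_mult from_local_in_point_ideal assms(1)) auto
    then show ?case using insert by (simp add: mult.assoc)
  qed
  have "(\<Prod>v\<in>UNIV. from_local a v ^ Poly_Mapping.lookup e v) \<in> ideal_pow ?I m"
    if "e \<in> Poly_Mapping.keys (localize a f)" for e
  proof -
    have "m \<le> off_degree (pivot a) e" using assms(2) that by (auto simp: order_ge_def)
    then obtain k where k: "off_degree (pivot a) e = m + k" using le_Suc_ex by blast
    have "(\<Prod>v\<in>UNIV - {pivot a}. from_local a v ^ Poly_Mapping.lookup e v) *
        from_local a (pivot a) ^ Poly_Mapping.lookup e (pivot a) \<in> ideal_pow ?I (m + k)"
      unfolding k[symmetric] off_degree_def by (rule prod) auto
    moreover have "(\<Prod>v\<in>UNIV. from_local a v ^ Poly_Mapping.lookup e v) =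
      (\<Prod>v\<in>UNIV - {pivot a}. from_local a v ^ Poly_Mapping.lookup e v) *
        from_local a (pivot a) ^ Poly_Mapping.lookup e (pivot a)"
      by (subst prod.remove[of UNIV "pivot a"]) (auto simp: mult.commute)
    ultimately have "(\<Prod>v\<in>UNIV. from_local a v ^ Poly_Mapping.lookup e v) \<in> ideal_pow ?I (m + k)" by simp
    then show ?thesis
      using ideal_pow_antimono[of ?I] by (simp add: point_ideal_def ideal_gen_mult)
  qed
  then have "delocalize a (localize a f) \<in> ideal_pow ?I m"
    unfolding delocalize_def mpoly_hom_def ideal_pow_def
    by (intro ideal_gen_sum ideal_gen_mult) (auto simp: ideal_pow_def)
  then show ?thesis by (simp add: delocalize_localize[OF assms(1)])
qed

lemma ideal_pow_iff:
  "a \<noteq> 0 \<Longrightarrow> f \<in> ideal_pow (point_ideal a) m \<longleftrightarrow> localize a f \<in> order_ge (pivot a) m"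
  using localize_ideal_pow ideal_pow_localize by blast

lemma point_ideal_eval: "f \<in> point_ideal a \<Longrightarrow> eval f a = 0"
  unfolding point_ideal_def
  by (induction rule: ideal_gen_induct) (auto simp: eval_add eval_mult eval_zero)

lemma points_ideal_iff: "f \<in> forms d \<Longrightarrow> f \<in> points_ideal Y \<longleftrightarrow> (\<forall>a\<in>Y. eval f a = 0)"
  unfolding points_ideal_def using point_ideal_eval
  by (auto simp: point_ideal_def intro!: ideal_gen_base)

section \<open>Counting exponents\<close>

lemma finite_total_degree: "finite {e :: 'v::finite \<Rightarrow>\<^sub>0 nat. total_degree e = d}"
proof (rule finite_imageD)
  have "Poly_Mapping.lookup ` {e :: 'v \<Rightarrow>\<^sub>0 nat. total_degree e = d} \<subseteq> PiE UNIV (\<lambda>_. {..d})"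
    by (auto simp: total_degree_def intro!: member_le_sum)
  then show "finite (Poly_Mapping.lookup ` {e :: 'v \<Rightarrow>\<^sub>0 nat. total_degree e = d})"
    by (rule finite_subset) (auto intro: finite_PiE)
  show "inj_on Poly_Mapping.lookup {e :: 'v \<Rightarrow>\<^sub>0 nat. total_degree e = d}"
    by (simp add: inj_on_def)
qed

lemma card_total_degree:
  "card {e :: 'v::finite \<Rightarrow>\<^sub>0 nat. total_degree e = N} = (N + CARD('v) - 1) choose N"
proof -
  obtain vs :: "'v list" where vs: "set vs = UNIV" "distinct vs"
    using finite_distinct_list[of "UNIV :: 'v set"] by auto
  have len: "length vs = CARD('v)" using vs distinct_card by fastforce
  have "bij_betw (\<lambda>e. map (Poly_Mapping.lookup e) vs) {e :: 'v \<Rightarrow>\<^sub>0 nat. total_degree e = N}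
      {l. length l = CARD('v) \<and> sum_list l = N}"
  proof (rule bij_betwI')
    fix x y :: "'v \<Rightarrow>\<^sub>0 nat"
    show "(map (Poly_Mapping.lookup x) vs = map (Poly_Mapping.lookup y) vs) = (x = y)"
      using vs by (auto intro: poly_mapping_eqI)
    show "x \<in> {e. total_degree e = N} \<Longrightarrow> map (Poly_Mapping.lookup x) vs \<in> {l. length l = CARD('v) \<and> sum_list l = N}"
      using vs len by (auto simp: total_degree_def sum_list_distinct_conv_sum_set)
  next
    fix l assume l: "l \<in> {l. length l = CARD('v) \<and> sum_list l = N}"
    define h where "h v = the (map_of (zip vs l) v)" for v
    define e where "e = Abs_poly_mapping h"
    have "Poly_Mapping.lookup e = h" unfolding e_def by (rule lookup_Abs_poly_mapping) simp
    moreover have "map h vs = l"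
      using l len vs(2) by (auto simp: h_def map_of_zip_nth intro!: nth_equalityI)
    ultimately have 1: "map (Poly_Mapping.lookup e) vs = l" by simp
    then have "total_degree e = N"
      using l vs by (metis (mono_tags, lifting) mem_Collect_eq sum_list_distinct_conv_sum_set total_degree_def)
    then show "\<exists>x\<in>{e. total_degree e = N}. l = map (Poly_Mapping.lookup x) vs" using 1 by auto
  qed
  from bij_betw_same_card[OF this] show ?thesis by (simp add: card_length_sum_list)
qed

text \<open>
  In degree \<open>j \<ge> m - 1\<close>, a monomial of off-degree less than \<open>m\<close> is divisible by the power \<open>j - (m - 1)\<close> of the variable
  \<open>p\<close>, and division by it gives all monomials of degree \<open>m - 1\<close>. The value is the degree of a fat
  point of multiplicity \<open>m\<close>.
\<close>

lemma card_off_degree_less: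
  assumes "1 \<le> m" "m \<le> Suc j"
  shows "card {e :: 'v::finite \<Rightarrow>\<^sub>0 nat. total_degree e = j \<and> off_degree p e < m} =
    (m + (CARD('v) - 1) - 1) choose (CARD('v) - 1)"
proof -
  let ?q = "Poly_Mapping.single p (j - (m - 1))"
  have "{e :: 'v \<Rightarrow>\<^sub>0 nat. total_degree e = j \<and> off_degree p e < m} =
      (\<lambda>e. e + ?q) ` {e. total_degree e = m - 1}"
  proof (intro set_eqI iffI)
    fix e :: "'v \<Rightarrow>\<^sub>0 nat" assume "e \<in> {e. total_degree e = j \<and> off_degree p e < m}"
    then have e: "total_degree e = j" "off_degree p e < m" by auto
    define r where "r = e - ?q"
    have "j - (m - 1) \<le> Poly_Mapping.lookup e p" using e total_degree_split[of e p] by auto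
    then have r: "r + ?q = e"
      unfolding r_def by (intro poly_mapping_eqI) (auto simp: lookup_add lookup_minus lookup_single when_def)
    have "total_degree r + (j - (m - 1)) = j"
      using e(1) unfolding r[symmetric] by (simp add: total_degree_add total_degree_single)
    then have "total_degree r = m - 1" using assms by linarith
    then show "e \<in> (\<lambda>e. e + ?q) ` {e. total_degree e = m - 1}"
      using r by (intro image_eqI[of e _ r]) auto
  next
    fix e :: "'v \<Rightarrow>\<^sub>0 nat" assume "e \<in> (\<lambda>e. e + ?q) ` {e. total_degree e = m - 1}"
    then obtain r where r: "e = r + ?q" "total_degree r = m - 1" by auto
    then show "e \<in> {e. total_degree e = j \<and> off_degree p e < m}"
      using assms total_degree_split[of r p]
      by (simp add: total_degree_add total_degree_single off_degree_add off_degree_single)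
  qed
  then have "card {e :: 'v \<Rightarrow>\<^sub>0 nat. total_degree e = j \<and> off_degree p e < m} =
      card {e :: 'v \<Rightarrow>\<^sub>0 nat. total_degree e = m - 1}"
    by (simp add: card_image inj_on_def)
  also have "\<dots> = (m - 1 + CARD('v) - 1) choose (m - 1)" by (rule card_total_degree)
  also have "\<dots> = (m + (CARD('v) - 1) - 1) choose (CARD('v) - 1)"
  proof -
    have "CARD('v) \<ge> 1" by (simp add: Suc_le_eq)
    then obtain n where "CARD('v) = Suc n" using not0_implies_Suc by fastforce
    then have "m - 1 + CARD('v) - 1 = m + (CARD('v) - 1) - 1"
      "m + (CARD('v) - 1) - 1 - (m - 1) = CARD('v) - 1" "m - 1 \<le> m + (CARD('v) - 1) - 1"
      using assms by auto
    then show ?thesis using binomial_symmetric[of "m - 1" "m + (CARD('v) - 1) - 1"] by simp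
  qed
  finally show ?thesis .
qed

section \<open>Conditions imposed on forms\<close>

lemma vector_space_mpoly: "vector_space (\<lambda>(c::'k::field) (f::('v::finite, 'k) mpoly). const c * f)"
  by unfold_locales (simp_all add: single_add distrib_left distrib_right mult_single flip: mult.assoc)

lemma monomials_span_forms:
  "forms d \<subseteq> module.span (\<lambda>(c::'k::field) (f::('v::finite, 'k) mpoly). const c * f)
     (monomial ` {e. total_degree e = d})"
proof
  interpret V: vector_space "\<lambda>(c::'k::field) (f::('v::finite, 'k) mpoly). const c * f"
    by (rule vector_space_mpoly)
  fix f :: "('v, 'k) mpoly" assume f: "f \<in> forms d"
  have "(\<Sum>e\<in>Poly_Mapping.keys f. const (Poly_Mapping.lookup f e) * monomial e)
      \<in> V.span (monomial ` {e. total_degree e = d})"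
    using f by (intro V.span_sum V.span_scale V.span_base) (auto simp: forms_alt)
  then show "f \<in> V.span (monomial ` {e. total_degree e = d})"
    by (simp add: mult_single flip: poly_mapping_as_sum)
qed

interpretation forms_space: finitely_spanned_subspace
  "\<lambda>(c::'k::field) (f::('v::finite, 'k) mpoly). const c * f" "forms d"
  "monomial ` {e. total_degree e = d}" for d
proof (intro finitely_spanned_subspace.intro finitely_spanned_subspace_axioms.intro vector_space_mpoly)
  interpret V: vector_space "\<lambda>(c::'k::field) (f::('v::finite, 'k) mpoly). const c * f"
    by (rule vector_space_mpoly)
  show "V.subspace (forms d)"
    by (intro V.subspaceI forms_zero forms_add forms_scale)
  show "finite (monomial ` {e. total_degree e = d} :: ('v, 'k) mpoly set)"
    using finite_total_degree by blast
  show "forms d \<subseteq> V.span (monomial ` {e. total_degree e = d})" by (rule monomials_span_forms)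
qed

lemma functional_eval: "forms_space.functional (\<lambda>f. eval f a)"
  by (simp add: forms_space.functional_def eval_add eval_mult eval_const)

lemma lookup_const_mult: "Poly_Mapping.lookup (const x * f) e = x * Poly_Mapping.lookup f e"
  by (simp flip: mult_map_scale_conv_mult add: map.rep_eq when_def)

lemma functional_local_coefficient:
  "forms_space.functional (\<lambda>f. Poly_Mapping.lookup (localize a f) e)"
  by (simp add: forms_space.functional_def localize_ring lookup_add lookup_const_mult)

text \<open>
  A quotient basis exists and all of them have the same size, so the choice made in \<open>quot_dim\<close> does
  not influence its value, which can be read off from functionals that cut out the ideal.
\<close>

lemma quot_dim_eq_codim:
  fixes I :: "('v::finite, 'k::field) mpoly set"
  assumes I: "0 \<in> I" "\<And>f g. f \<in> I \<Longrightarrow> g \<in> I \<Longrightarrow> f + g \<in> I" "\<And>c f. f \<in> I \<Longrightarrow> const c * f \<in> I"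
    and ann: "\<And>f. f \<in> forms d \<Longrightarrow> f \<in> I \<longleftrightarrow> (\<forall>\<phi>\<in>S. \<phi> f = 0)"
  shows "quot_dim I d = forms_space.codim d S"
proof -
  have sub: "forms_space.subspace I" using I by (intro forms_space.subspaceI)
  have "\<exists>B. quot_basis I d B"
    using forms_space.quotient_basis_exists[OF sub, of d] unfolding quot_basis_def by blast
  then obtain B where "quot_basis I d B" ..
  then have some: "quot_basis I d (SOME B. quot_basis I d B)" by (rule someI)
  have "card B = forms_space.dim (forms d :: ('v, 'k) mpoly set) - forms_space.dim (forms d \<inter> I)" if "quot_basis I d B" for B
  proof (rule forms_space.quotient_basis_card[OF sub])
    note B = that[unfolded quot_basis_def]
    show "finite B" "B \<subseteq> forms d" using B by blast+
    show "\<forall>b\<in>B. c b = 0" if "(\<Sum>b\<in>B. const (c b) * b) \<in> I" for c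
      using B that by blast
    show "\<exists>c. f - (\<Sum>b\<in>B. const (c b) * b) \<in> I" if "f \<in> forms d" for f
      using B that by blast
  qed
  from this[OF some] have "quot_dim I d = forms_space.dim (forms d :: ('v, 'k) mpoly set) - forms_space.dim (forms d \<inter> I)"
    unfolding quot_dim_def .
  moreover have "forms d \<inter> I = annihilator (forms d) S" unfolding annihilator_def using ann by blast
  ultimately show ?thesis unfolding forms_space.codim_def by simp
qed

abbreviation evaluations :: "('k::field ^ 'v::finite) set \<Rightarrow> (('v, 'k) mpoly \<Rightarrow> 'k) set" where
  "evaluations Y \<equiv> (\<lambda>a f. eval f a) ` Y"

lemma quot_dim_points_ideal: "quot_dim (points_ideal Y) d = forms_space.codim d (evaluations Y)"
  by (rule quot_dim_eq_codim)
    (auto simp: points_ideal_iff,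
      auto simp: points_ideal_def point_ideal_def ideal_gen_zero ideal_gen_add ideal_gen_mult)

lemma evaluation_nonzero_form:
  assumes "a \<noteq> 0" obtains f where "f \<in> forms d" "eval f a \<noteq> 0"
proof
  show "variable (pivot a) ^ d \<in> forms d" using forms_power[OF forms_variable, of _ d] by simp
  show "eval (variable (pivot a) ^ d) a \<noteq> 0"
    using pivot_nonzero[OF assms] by (simp add: eval_power eval_variable)
qed

text \<open>
  The linear forms \<open>from_local a v\<close> with \<open>v\<close> different from the pivot cut out the line spanned by
  \<open>a\<close>, so one of them is nonzero at \<open>b\<close>; a form that is nonzero at \<open>b\<close> raises the degree to \<open>d\<close>.
\<close>

lemma separating_form:
  assumes "a \<noteq> 0" "b \<noteq> 0" "\<not> same_point b a" "d \<ge> 1"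
  obtains f where "f \<in> forms d" "eval f a = 0" "eval f b \<noteq> 0"
proof -
  have "\<exists>v. v \<noteq> pivot a \<and> eval (from_local a v) b \<noteq> 0"
  proof (rule ccontr)
    assume "\<not> ?thesis"
    then have "b $ v = (b $ pivot a / a $ pivot a) * a $ v" for v
      using pivot_nonzero[OF assms(1)]
      by (cases "v = pivot a")
        (auto simp: from_local_def eval_minus eval_mult eval_const eval_variable)
    then have b: "b = (b $ pivot a / a $ pivot a) *s a"
      unfolding vec_eq_iff vector_smult_component by blast
    moreover have "b $ pivot a / a $ pivot a \<noteq> 0"
      using b assms(2) by (metis vector_smult_lzero)
    ultimately show False using assms(3) unfolding same_point_def by blast
  qed
  then obtain v where v: "v \<noteq> pivot a" "eval (from_local a v) b \<noteq> 0" by blast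
  obtain g where g: "g \<in> forms (d - 1)" "eval g b \<noteq> 0"
    using evaluation_nonzero_form[OF assms(2)] .
  show ?thesis
  proof (rule that[of "from_local a v * g"])
    show "from_local a v * g \<in> forms d" using forms_mult[OF forms_from_local g(1), of a v] assms(4) by simp
    show "eval (from_local a v * g) a = 0"
      using point_ideal_eval[OF from_local_in_point_ideal[OF assms(1) v(1)]] by (simp add: eval_mult)
    show "eval (from_local a v * g) b \<noteq> 0" using v g by (simp add: eval_mult)
  qed
qed

lemma codim_single_point: "a \<noteq> 0 \<Longrightarrow> forms_space.codim d {\<lambda>f. eval f a} = 1"
  using forms_space.codim_insert[of "\<lambda>f. eval f a" "{}" d] evaluation_nonzero_form[of a d]
  by (auto simp: functional_eval forms_space.codim_empty annihilator_def)

lemma codim_two_points: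
  assumes "a \<noteq> 0" "b \<noteq> 0" "\<not> same_point b a" "d \<ge> 1"
  shows "forms_space.codim d {\<lambda>f. eval f b, \<lambda>f. eval f a} = 2"
proof -
  obtain f where "f \<in> forms d" "eval f a = 0" "eval f b \<noteq> 0" using separating_form[OF assms] .
  then have "\<exists>f\<in>annihilator (forms d) {\<lambda>f. eval f a}. eval f b \<noteq> 0"
    unfolding annihilator_def by auto
  moreover have "forms_space.functional \<psi>" if "\<psi> \<in> {\<lambda>f. eval f b, \<lambda>f. eval f a}" for \<psi>
    using that functional_eval by auto
  ultimately show ?thesis
    using forms_space.codim_insert[of "\<lambda>f. eval f b" "{\<lambda>f. eval f a}" d] codim_single_point[OF assms(1), of d]
    by simp
qed

lemma submodular_codim:
  fixes \<phi> :: "'e \<Rightarrow> ('v::finite, 'k::field) mpoly \<Rightarrow> 'k"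
  assumes "finite S0" "\<And>\<psi>. \<psi> \<in> S0 \<Longrightarrow> forms_space.functional \<psi>"
    "\<And>e. forms_space.functional (\<phi> e)"
  shows "submodular (\<lambda>X. int (forms_space.codim d (S0 \<union> \<phi> ` X)) - c)"
  unfolding submodular_def
proof (intro allI impI)
  fix X Y :: "'e set" assume "finite X" "finite Y"
  then have "forms_space.codim d ((S0 \<union> \<phi> ` X) \<union> (S0 \<union> \<phi> ` Y)) +
      forms_space.codim d ((S0 \<union> \<phi> ` X) \<inter> (S0 \<union> \<phi> ` Y))
    \<le> forms_space.codim d (S0 \<union> \<phi> ` X) + forms_space.codim d (S0 \<union> \<phi> ` Y)"
    using assms by (intro forms_space.codim_submodular) auto
  moreover have "(S0 \<union> \<phi> ` X) \<union> (S0 \<union> \<phi> ` Y) = S0 \<union> \<phi> ` (X \<union> Y)" by auto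
  moreover have "forms_space.codim d (S0 \<union> \<phi> ` (X \<inter> Y)) \<le>
      forms_space.codim d ((S0 \<union> \<phi> ` X) \<inter> (S0 \<union> \<phi> ` Y))"
    by (rule forms_space.codim_mono) auto
  ultimately show "int (forms_space.codim d (S0 \<union> \<phi> ` (X \<union> Y))) - c +
      (int (forms_space.codim d (S0 \<union> \<phi> ` (X \<inter> Y))) - c)
    \<le> int (forms_space.codim d (S0 \<union> \<phi> ` X)) - c + (int (forms_space.codim d (S0 \<union> \<phi> ` Y)) - c)"
    by simp
qed

section \<open>Forms with prescribed local leading term\<close>

text \<open>
  A fat point scheme is encoded by a finite set \<open>A\<close> of labels and a map \<open>pt\<close> to points; the
  multiplicity of a point is the number of its labels, all of which carry the same vector. Labels rather than multiplicities make sets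
  of labels available as arguments of rank functions.
\<close>

definition vanishes_along :: "('e \<Rightarrow> 'k ^ 'v) \<Rightarrow> 'e set \<Rightarrow> ('v::finite, 'k::field) mpoly \<Rightarrow> bool" where
  "vanishes_along pt A F \<longleftrightarrow>
     (\<forall>b. localize b F \<in> order_ge (pivot b) (card {e \<in> A. pt e = b}))"

lemma vanishes_along_zero: "vanishes_along pt A 0"
  by (simp add: vanishes_along_def localize_ring order_ge_zero)

lemma vanishes_along_add:
  "vanishes_along pt A F \<Longrightarrow> vanishes_along pt A G \<Longrightarrow> vanishes_along pt A (F + G)"
  by (simp add: vanishes_along_def localize_ring order_ge_add)

lemma vanishes_along_scale: "vanishes_along pt A F \<Longrightarrow> vanishes_along pt A (G * F)"
  by (simp add: vanishes_along_def localize_ring order_ge_scale)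

text \<open>
  A factor that vanishes at the points of \<open>J\<close> contributes one to the multiplicity of each of them.
  Injectivity is essential here, since no point may be counted twice for one factor.
\<close>

lemma vanishes_along_mult:
  assumes "finite A" "J \<subseteq> A" "inj_on pt J"
    and l: "l \<in> forms d" "\<And>e. e \<in> J \<Longrightarrow> eval l (pt e) = 0"
    and F: "vanishes_along pt (A - J) F"
  shows "vanishes_along pt A (l * F)"
  unfolding vanishes_along_def
proof
  fix b
  let ?c = "\<lambda>A. card {e \<in> A. pt e = b}"
  have Fb: "localize b F \<in> order_ge (pivot b) (?c (A - J))"
    using F by (simp add: vanishes_along_def)
  have "finite J" using assms(1,2) finite_subset by blast
  then have fin: "finite {e \<in> J. pt e = b}" "finite {e \<in> A - J. pt e = b}"
    using assms(1) by auto
  have "{e \<in> A. pt e = b} = {e \<in> J. pt e = b} \<union> {e \<in> A - J. pt e = b}" using assms(2) by auto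
  then have card: "?c A = ?c J + ?c (A - J)"
    using fin by (simp add: card_Un_disjoint disjoint_iff)
  show "localize b (l * F) \<in> order_ge (pivot b) (?c A)"
  proof (cases "{e \<in> J. pt e = b} = {}")
    case True
    then have "?c J = 0" by (simp only: card.empty)
    then have "?c A = ?c (A - J)" using card by simp
    then show ?thesis using Fb by (simp add: localize_ring order_ge_scale)
  next
    case False
    then obtain e where e: "e \<in> J" "pt e = b" by auto
    have "{e \<in> J. pt e = b} = {e}" using e assms(3) by (auto simp: inj_on_def)
    then have "?c A = 1 + ?c (A - J)" using card by simp
    moreover have "localize b l \<in> order_ge (pivot b) 1"
      using localize_order_ge_1[OF l(1), of b] l(2)[OF e(1)] e(2) by simp
    then have "localize b l * localize b F \<in> order_ge (pivot b) (1 + ?c (A - J))"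
      using Fb by (rule order_ge_mult)
    ultimately show ?thesis by (simp only: localize_ring)
  qed
qed

text \<open>
  For \<open>a \<noteq> 0\<close>, the number of conditions that the points of \<open>X\<close> impose on the forms of degree \<open>d\<close> that vanish
  at \<open>a\<close>: the rank of the contraction by \<open>a\<close>.
\<close>

definition relative_rank :: "nat \<Rightarrow> 'k::field ^ 'v \<Rightarrow> ('e \<Rightarrow> 'k ^ 'v::finite) \<Rightarrow> 'e set \<Rightarrow> int" where
  "relative_rank d a pt X = int (forms_space.codim d ({\<lambda>f. eval f a} \<union> (\<lambda>e f. eval f (pt e)) ` X)) - (1::int)"

lemma submodular_relative_rank: "submodular (relative_rank d a pt)"
  unfolding relative_rank_def
  by (rule submodular_codim) (auto simp: functional_eval)

lemma relative_rank_empty: "relative_rank d a pt {} \<le> 0"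
  using forms_space.codim_le_card[of "{\<lambda>f. eval f a}" d]
  by (simp add: relative_rank_def functional_eval)

text \<open>
  Two labels of one point impose the same condition and so cannot be independent modulo \<open>S0\<close>.
\<close>

lemma inj_on_of_rank_bound:
  assumes "\<And>X. X \<subseteq> J \<Longrightarrow> int (card X) \<le> int (forms_space.codim d (S0 \<union> (\<lambda>e f. eval f (pt e)) ` X)) - int (card S0)"
    and "finite S0" "\<And>\<psi>. \<psi> \<in> S0 \<Longrightarrow> forms_space.functional \<psi>"
  shows "inj_on pt J"
proof (rule inj_onI, rule ccontr)
  fix e e' assume e: "e \<in> J" "e' \<in> J" "pt e = pt e'" "e \<noteq> e'"
  have "(\<lambda>e f. eval f (pt e)) ` {e, e'} = {\<lambda>f. eval f (pt e)}" using e(3) by auto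
  moreover have "forms_space.codim d (S0 \<union> {\<lambda>f. eval f (pt e)}) \<le> forms_space.codim d S0 + card {\<lambda>f. eval f (pt e)}"
    by (rule forms_space.codim_union_le_card) (use assms(3) in \<open>auto simp: functional_eval\<close>)
  moreover have "forms_space.codim d S0 \<le> card S0"
    by (rule forms_space.codim_le_card) (use assms(2,3) in auto)
  ultimately show False using assms(1)[of "{e, e'}"] e by auto
qed

text \<open>
  If \<open>J\<close> has full rank modulo \<open>q\<close> and \<open>S0\<close>, then \<open>q\<close> is independent of the conditions given by
  \<open>S0\<close> and \<open>J\<close>.
\<close>

lemma witness_of_rank_bound:
  assumes "int (card J) \<le> int (forms_space.codim d (insert q S0 \<union> (\<lambda>e f. eval f (pt e)) ` J)) - int (Suc (card S0))"
    and "finite S0" "finite J" "\<And>\<psi>. \<psi> \<in> insert q S0 \<Longrightarrow> forms_space.functional \<psi>"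
  obtains f where "f \<in> annihilator (forms d) (S0 \<union> (\<lambda>e f. eval f (pt e)) ` J)" "q f \<noteq> 0"
proof -
  let ?E = "(\<lambda>e f. eval f (pt e)) ` J"
  have "forms_space.codim d (S0 \<union> ?E) \<le> forms_space.codim d S0 + card ?E"
    by (rule forms_space.codim_union_le_card) (use assms(3,4) in \<open>auto simp: functional_eval\<close>)
  moreover have "forms_space.codim d S0 \<le> card S0"
    by (rule forms_space.codim_le_card) (use assms(2,4) in auto)
  moreover have "card ?E \<le> card J" using assms(3) by (rule card_image_le)
  ultimately have "forms_space.codim d (S0 \<union> ?E) < forms_space.codim d (insert q (S0 \<union> ?E))"
    using assms(1) by simp
  moreover have "\<And>\<psi>. \<psi> \<in> insert q (S0 \<union> ?E) \<Longrightarrow> forms_space.functional \<psi>"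
    using assms(4) functional_eval by auto
  ultimately show ?thesis using forms_space.codim_increase_witness that by blast
qed

text \<open>
  The forms that can serve as one factor of a product: they vanish at \<open>a\<close> and on a set \<open>J\<close> of
  distinct points after whose removal the numerical condition holds for the remaining degree.
\<close>

definition splitting_forms :: "nat \<Rightarrow> 'k::field ^ 'v::finite \<Rightarrow> ('e \<Rightarrow> 'k ^ 'v) \<Rightarrow> 'e set \<Rightarrow> nat \<Rightarrow> nat \<Rightarrow> ('v, 'k) mpoly set" where
  "splitting_forms d a pt A t k = {l \<in> forms d. eval l a = 0 \<and>
     (\<exists>J\<subseteq>A. inj_on pt J \<and> (\<forall>e\<in>J. eval l (pt e) = 0) \<and>
       (\<forall>B\<subseteq>A - J. B \<noteq> {} \<longrightarrow> int (card B) + int k \<le> int t * relative_rank d a pt B))}"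

text \<open>
  Suppose that some functional \<open>q\<close> vanishes on all splitting forms, but not on all forms of degree
  \<open>d\<close> that vanish at \<open>a\<close>. Then \<open>a\<close> and \<open>q\<close> are independent, and contracting by \<open>q\<close> as well as \<open>a\<close>
  lowers ranks by at most one. The partition result gives a set \<open>J\<close> that is independent modulo \<open>a\<close>
  and \<open>q\<close>, hence a form that vanishes at \<open>a\<close> and on \<open>J\<close> but not under \<open>q\<close>. It is a splitting form,
  a contradiction. Arguing with one functional at a time avoids any genericity assumption and thus
  works over finite fields, too.
\<close>

lemma splitting_forms_span:
  assumes "a \<noteq> 0" "finite A" "k \<le> t"
    and bound: "\<And>B. B \<subseteq> A \<Longrightarrow> B \<noteq> {} \<Longrightarrow> int (card B) + int (Suc k) \<le> int (Suc t) * relative_rank d a pt B"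
    and g: "g \<in> forms d" "eval g a = 0"
  shows "g \<in> forms_space.span (splitting_forms d a pt A t k)"
proof (rule ccontr)
  let ?U = "forms_space.span (splitting_forms d a pt A t k)"
  let ?\<phi> = "\<lambda>e f. eval f (pt e)"
  assume "g \<notin> ?U"
  then obtain q where q: "forms_space.functional q" "q g = 1" "\<And>u. u \<in> ?U \<Longrightarrow> q u = 0"
    using forms_space.separating_functional[OF forms_space.subspace_span] by metis
  let ?S0 = "{\<lambda>f. eval f a}"
  define rk' where "rk' X = int (forms_space.codim d (insert q ?S0 \<union> ?\<phi> ` X)) - (2::int)" for X
  have fS: "\<psi> \<in> insert q ?S0 \<Longrightarrow> forms_space.functional \<psi>" for \<psi> using q(1) functional_eval by auto
  have sub': "submodular rk'"
    unfolding rk'_def by (rule submodular_codim) (use fS in \<open>auto simp: functional_eval\<close>)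
  have qS: "forms_space.codim d (insert q ?S0) = 2"
  proof -
    have "\<exists>f\<in>annihilator (forms d) ?S0. q f \<noteq> 0" using g q(2) by (intro bexI[of _ g]) (auto simp: annihilator_def)
    then show ?thesis using forms_space.codim_insert[of q ?S0 d] fS codim_single_point[OF assms(1), of d] by simp
  qed
  obtain J where J: "J \<subseteq> A" "\<And>X. X \<subseteq> J \<Longrightarrow> int (card X) \<le> rk' X"
    "\<And>B. B \<subseteq> A - J \<Longrightarrow> B \<noteq> {} \<Longrightarrow> int (card B) + (int (Suc k) - 1) \<le> (int (Suc t) - 1) * relative_rank d a pt B"
  proof (rule splitting_off_rank[OF submodular_relative_rank sub' relative_rank_empty _ _ _ assms(2) _ _ bound])
    show "rk' {} \<le> 0" using qS by (simp add: rk'_def)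
    show "0 \<le> rk' X" for X
      using qS forms_space.codim_mono[of "insert q ?S0" "insert q ?S0 \<union> ?\<phi> ` X" d] by (simp add: rk'_def)
    show "relative_rank d a pt X - 1 \<le> rk' X" for X
      using forms_space.codim_mono[of "?S0 \<union> ?\<phi> ` X" "insert q ?S0 \<union> ?\<phi> ` X" d]
      by (simp add: rk'_def relative_rank_def subset_insertI)
  qed (use assms(3) in auto)
  have finJ: "finite J" using J(1) assms(2) finite_subset by blast
  obtain l where l: "l \<in> annihilator (forms d) (?S0 \<union> ?\<phi> ` J)" "q l \<noteq> 0"
    using witness_of_rank_bound[of J d q ?S0 pt] J(2)[of J] finJ fS unfolding rk'_def by auto
  have "card (insert q ?S0) \<le> 2" by (simp add: card_insert_le_m1)
  have "inj_on pt J"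
  proof (rule inj_on_of_rank_bound)
    show "int (card X) \<le> int (forms_space.codim d (insert q ?S0 \<union> ?\<phi> ` X)) - int (card (insert q ?S0))"
      if "X \<subseteq> J" for X
      using J(2)[OF that] \<open>card (insert q ?S0) \<le> 2\<close> unfolding rk'_def by linarith
  qed (use fS in auto)
  then have "l \<in> splitting_forms d a pt A t k"
    unfolding splitting_forms_def using l(1) J(1,3) by (auto simp: annihilator_def intro!: exI[of _ J])
  then show False using l(2) q(3) forms_space.span_base by blast
qed

text \<open>
  The analogue for factors that do not vanish at \<open>a\<close>. As \<open>k\<close> is \<open>0\<close>, both functions to be split
  between are multiples of one rank function.
\<close>

lemma splitting_unit_form:
  assumes "a \<noteq> 0" "finite A"
    and bound: "\<And>B. B \<subseteq> A \<Longrightarrow> B \<noteq> {} \<Longrightarrow> int (card B) \<le> int (Suc t) * relative_rank d a pt B"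
  obtains h J where "h \<in> forms d" "eval h a = 1" "J \<subseteq> A" "inj_on pt J"
    "\<And>e. e \<in> J \<Longrightarrow> eval h (pt e) = 0"
    "\<And>B. B \<subseteq> A - J \<Longrightarrow> B \<noteq> {} \<Longrightarrow> int (card B) \<le> int t * relative_rank d a pt B"
proof -
  let ?\<phi> = "\<lambda>e f. eval f (pt e)"
  have rk0: "relative_rank d a pt {} = 0"
    using codim_single_point[OF assms(1), of d] by (simp add: relative_rank_def)
  have sub: "submodular (\<lambda>X. int t * relative_rank d a pt X)"
    unfolding submodular_def
  proof (intro allI impI)
    fix X Y :: "'c set" assume "finite X" "finite Y"
    then show "int t * relative_rank d a pt (X \<union> Y) + int t * relative_rank d a pt (X \<inter> Y)
      \<le> int t * relative_rank d a pt X + int t * relative_rank d a pt Y"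
      using submodularD[OF submodular_relative_rank, of X Y d a pt]
      by (simp flip: distrib_left add: mult_left_mono)
  qed
  have "int (card B) \<le> relative_rank d a pt B + int t * relative_rank d a pt B" if "B \<subseteq> A" for B
    using bound[OF that] rk0 by (cases "B = {}") (auto simp: algebra_simps)
  then obtain J where J: "J \<subseteq> A" "\<And>X. X \<subseteq> J \<Longrightarrow> int (card X) \<le> relative_rank d a pt X"
    "\<And>X. X \<subseteq> A - J \<Longrightarrow> int (card X) \<le> int t * relative_rank d a pt X"
    using submodular_splitting[OF submodular_relative_rank[of d a pt] sub _ _ assms(2)] rk0 by auto
  have finJ: "finite J" using J(1) assms(2) finite_subset by blast
  have "int (card J) \<le> int (forms_space.codim d (insert (\<lambda>f. eval f a) {} \<union> ?\<phi> ` J)) - int (Suc (card ({} :: (('b, 'a) mpoly \<Rightarrow> 'a) set)))"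
    using J(2)[of J] by (simp add: relative_rank_def)
  then obtain f where f: "f \<in> annihilator (forms d) ({} \<union> ?\<phi> ` J)" "eval f a \<noteq> 0"
    by (rule witness_of_rank_bound) (use finJ functional_eval in auto)
  show ?thesis
  proof (rule that[of "const (1 / eval f a) * f" J])
    show "const (1 / eval f a) * f \<in> forms d" using f by (auto simp: annihilator_def intro: forms_scale)
    show "eval (const (1 / eval f a) * f) a = 1" using f by (simp add: eval_mult eval_const)
    show "eval (const (1 / eval f a) * f) (pt e) = 0" if "e \<in> J" for e
      using f that by (auto simp: annihilator_def eval_mult)
    show "inj_on pt J"
      using J(2) functional_eval by (intro inj_on_of_rank_bound[of J d "{\<lambda>f. eval f a}"]) (auto simp: relative_rank_def)
  qed (use J in auto)
qed

text \<open>
  Induction on the number \<open>t\<close> of factors of degree \<open>d\<close>. If \<open>k = 0\<close>, one factor is a form with value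
  \<open>1\<close> at \<open>a\<close>. Otherwise one local coordinate \<open>x\<^sub>v\<close> is split off from the monomial, as the form \<open>g\<close> of
  degree \<open>d\<close> whose expansion at \<open>a\<close> is \<open>x\<^sub>v\<close> times a power of the pivot variable. It is a combination
  of splitting forms \<open>l\<close>, for each of which the induction hypothesis provides the remaining factor
  with the same leading monomial; the products may therefore be added up.
\<close>

lemma exists_form_with_leading_monomial:
  assumes "a \<noteq> 0" "finite A" "k \<le> t" "d \<ge> 1"
    and "\<And>B. B \<subseteq> A \<Longrightarrow> B \<noteq> {} \<Longrightarrow> int (card B) + int k \<le> int t * relative_rank d a pt B"
    and "total_degree \<beta> = d * t" "off_degree (pivot a) \<beta> = k"
  shows "\<exists>F\<in>forms (d * t). localize a F - monomial \<beta> \<in> order_ge (pivot a) (Suc k) \<and> vanishes_along pt A F"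
  using assms(2,3,5-7)
proof (induction t arbitrary: k A \<beta>)
  case 0
  have "A = {}"
  proof (rule ccontr)
    assume "A \<noteq> {}"
    then have "card A = 0" using 0(3)[of A] by simp
    then show False using \<open>A \<noteq> {}\<close> 0(1) by simp
  qed
  moreover have "\<beta> = 0" using 0 off_degree_eq_0[of "pivot a" \<beta>] by simp
  ultimately show ?case
    by (intro bexI[of _ 1]) (auto simp: localize_ring order_ge_zero vanishes_along_def order_ge_0 forms_one)
next
  case (Suc t)
  let ?p = "pivot a"
  let ?r = "relative_rank d a pt"
  show ?case
  proof (cases k)
    case 0
    obtain h J where h: "h \<in> forms d" "eval h a = 1" "J \<subseteq> A" "inj_on pt J"
      "\<And>e. e \<in> J \<Longrightarrow> eval h (pt e) = 0"
      "\<And>B. B \<subseteq> A - J \<Longrightarrow> B \<noteq> {} \<Longrightarrow> int (card B) \<le> int t * ?r B"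
      by (rule splitting_unit_form[OF assms(1) Suc.prems(1), of t d pt]) (use Suc.prems(3) 0 in auto)
    define \<gamma> where "\<gamma> = Poly_Mapping.single ?p (d * t)"
    have "\<exists>F\<in>forms (d * t). localize a F - monomial \<gamma> \<in> order_ge ?p (Suc 0) \<and> vanishes_along pt (A - J) F"
      by (rule Suc.IH) (use h Suc.prems(1) in \<open>auto simp: \<gamma>_def total_degree_single off_degree_single\<close>)
    then obtain F where F: "F \<in> forms (d * t)" "localize a F - monomial \<gamma> \<in> order_ge ?p 1"
      "vanishes_along pt (A - J) F" by auto
    have \<beta>: "monomial \<beta> = monomial (Poly_Mapping.single ?p d) * (monomial \<gamma> :: ('b, 'a) mpoly)"
      using off_degree_eq_0[of ?p \<beta>] Suc.prems(4,5) 0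
      by (simp add: \<gamma>_def mult_single flip: single_add)
    have "localize a h - monomial (Poly_Mapping.single ?p d) \<in> order_ge ?p 1"
    proof (rule forms_order_ge_1)
      show "localize a h - monomial (Poly_Mapping.single ?p d) \<in> forms d"
        using forms_localize[OF h(1)] forms_monomial[of "Poly_Mapping.single ?p d"]
        by (intro forms_diff) (auto simp: total_degree_single)
      show "Poly_Mapping.lookup (localize a h - monomial (Poly_Mapping.single ?p d)) (Poly_Mapping.single ?p d) = 0"
        using lookup_localize_pivot[OF h(1)] h(2) by (simp add: lookup_minus)
    qed
    then have "monomial \<gamma> * (localize a h - monomial (Poly_Mapping.single ?p d)) + localize a h * (localize a F - monomial \<gamma>) \<in> order_ge ?p 1"
      using F(2) by (intro order_ge_add order_ge_scale)
    moreover have "localize a (h * F) - monomial \<beta> =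
      monomial \<gamma> * (localize a h - monomial (Poly_Mapping.single ?p d)) + localize a h * (localize a F - monomial \<gamma>)"
      unfolding \<beta> by (simp add: localize_ring algebra_simps)
    ultimately have "localize a (h * F) - monomial \<beta> \<in> order_ge ?p (Suc k)" using 0 by simp
    moreover have "h * F \<in> forms (d * Suc t)" using forms_mult[OF h(1) F(1)] by simp
    moreover have "vanishes_along pt A (h * F)"
      using vanishes_along_mult[OF Suc.prems(1) h(3,4,1,5) F(3)] .
    ultimately show ?thesis by blast
  next
    case (Suc k')
    have "off_degree ?p \<beta> \<noteq> 0" using Suc.prems(5) Suc by simp
    then obtain v where v: "v \<noteq> ?p" "Poly_Mapping.lookup \<beta> v \<noteq> 0"
      unfolding off_degree_def by (metis DiffD2 insertI1 sum.neutral)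
    define \<alpha> where "\<alpha> = Poly_Mapping.single v 1 + Poly_Mapping.single ?p (d - 1)"
    define \<gamma> where "\<gamma> = \<beta> - \<alpha>"
    \<comment> \<open>The pivot variable occurs often enough in \<open>\<beta>\<close> to fill up \<open>x\<^sub>v\<close> to a form of degree \<open>d\<close>.\<close>
    have "(d - 1) * 1 \<le> (d - 1) * Suc t" by (intro mult_le_mono2) simp
    then have "d - 1 + k \<le> d * Suc t" using Suc.prems(2) assms(4)
      by (cases d) (auto simp: algebra_simps)
    then have "d - 1 \<le> Poly_Mapping.lookup \<beta> ?p"
      using total_degree_split[of \<beta> ?p] Suc.prems(4,5) by linarith
    then have \<beta>: "\<beta> = \<alpha> + \<gamma>"
      using v unfolding \<gamma>_def \<alpha>_def
      by (intro poly_mapping_eqI) (auto simp: lookup_add lookup_minus lookup_single when_def)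
    have \<alpha>: "total_degree \<alpha> = d" "off_degree ?p \<alpha> = 1"
      using v assms(4) by (auto simp: \<alpha>_def total_degree_add off_degree_add total_degree_single off_degree_single)
    have \<gamma>: "total_degree \<gamma> = d * t" "off_degree ?p \<gamma> = k'"
      using Suc.prems(4,5) \<alpha> Suc unfolding \<beta> by (auto simp: total_degree_add off_degree_add)
    define g where "g = delocalize a (monomial \<alpha>)"
    have g: "g \<in> forms d" "localize a g = monomial \<alpha>"
      unfolding g_def using forms_delocalize[OF forms_monomial[of \<alpha>]] \<alpha>(1) localize_delocalize[OF assms(1)] by auto
    have "\<alpha> \<noteq> Poly_Mapping.single ?p d" using \<alpha>(2) by (auto simp: off_degree_single)
    then have "eval g a = 0"
      using lookup_localize_pivot[OF g(1), of a] g(2) by (simp add: lookup_single when_def)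
    then have "g \<in> forms_space.span (splitting_forms d a pt A t k')"
      using splitting_forms_span[OF assms(1) Suc.prems(1), of k' t d pt g] Suc Suc.prems(2,3) g(1) by auto
    then have "\<exists>F\<in>forms (d * Suc t). localize a F - localize a g * monomial \<gamma> \<in> order_ge ?p (Suc k) \<and> vanishes_along pt A F"
    proof (induction rule: forms_space.span_induct_alt)
      case base
      show ?case by (intro bexI[of _ 0]) (auto simp: localize_ring order_ge_zero vanishes_along_zero forms_zero)
    next
      case (step c l y)
      obtain G where G: "G \<in> forms (d * Suc t)"
        "localize a G - localize a y * monomial \<gamma> \<in> order_ge ?p (Suc k)" "vanishes_along pt A G"
        using step(2) by blast
      obtain J where J: "l \<in> forms d" "eval l a = 0" "J \<subseteq> A" "inj_on pt J" "\<And>e. e \<in> J \<Longrightarrow> eval l (pt e) = 0"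
        "\<And>B. B \<subseteq> A - J \<Longrightarrow> B \<noteq> {} \<Longrightarrow> int (card B) + int k' \<le> int t * ?r B"
        using step(1) unfolding splitting_forms_def by blast
      have "\<exists>F\<in>forms (d * t). localize a F - monomial \<gamma> \<in> order_ge ?p (Suc k') \<and> vanishes_along pt (A - J) F"
        by (rule Suc.IH) (use J(6) Suc Suc.prems(1,2) \<gamma> in auto)
      then obtain F where F: "F \<in> forms (d * t)" "localize a F - monomial \<gamma> \<in> order_ge ?p k"
        "vanishes_along pt (A - J) F" using Suc by auto
      have "localize a l * (localize a F - monomial \<gamma>) \<in> order_ge ?p (1 + k)"
        using F(2) localize_order_ge_1[OF J(1,2)] by (rule order_ge_mult[rotated])
      then have "const c * (localize a l * (localize a F - monomial \<gamma>)) + (localize a G - localize a y * monomial \<gamma>)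
          \<in> order_ge ?p (Suc k)"
        using order_ge_add[OF order_ge_scale G(2)] by simp
      moreover have "localize a (const c * (l * F) + G) - localize a (const c * l + y) * monomial \<gamma> =
        const c * (localize a l * (localize a F - monomial \<gamma>)) + (localize a G - localize a y * monomial \<gamma>)"
        by (simp add: localize_ring algebra_simps)
      moreover have "const c * (l * F) + G \<in> forms (d * Suc t)"
        using forms_mult[OF J(1) F(1)] G(1) by (intro forms_add forms_scale) auto
      moreover have "vanishes_along pt A (const c * (l * F) + G)"
        using vanishes_along_add[OF vanishes_along_scale G(3)]
          vanishes_along_mult[OF Suc.prems(1) J(3,4,1,5) F(3)] by blast
      ultimately show ?case by (metis (no_types, lifting))
    qed
    moreover have "localize a g * monomial \<gamma> = monomial \<beta>"
      using g(2) \<beta> by (simp add: mult_single)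
    ultimately show ?thesis by simp
  qed
qed

section \<open>The regularity bound\<close>

lemma scheme_ideal_iff:
  assumes "\<And>i. i \<in> {1..s} \<Longrightarrow> P i \<noteq> 0"
  shows "f \<in> scheme_ideal s P m \<longleftrightarrow> (\<forall>i\<in>{1..s}. localize (P i) f \<in> order_ge (pivot (P i)) (m i))"
proof -
  have "f \<in> ideal_pow (point_ideal (P i)) (m i) \<longleftrightarrow> localize (P i) f \<in> order_ge (pivot (P i)) (m i)"
    if "i \<in> {1..s}" for i
    using ideal_pow_iff[OF assms[OF that]] .
  then show ?thesis unfolding scheme_ideal_def by blast
qed

lemma fat_point_schemeD:
  assumes "fat_point_scheme s P m" "i \<in> {1..s}"
  shows "P i \<noteq> 0" "m i > 0" "\<And>j. j \<in> {1..s} \<Longrightarrow> i \<noteq> j \<Longrightarrow> \<not> same_point (P i) (P j)"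
  using assms unfolding fat_point_scheme_def by simp_all

lemma fat_point_scheme_inj:
  assumes "fat_point_scheme s P m" shows "inj_on P {1..s}"
proof (rule inj_onI, rule ccontr)
  fix i j assume ij: "i \<in> {1..s}" "j \<in> {1..s}" "P i = P j" "i \<noteq> j"
  have "same_point (P i) (P j)" unfolding same_point_def ij(3) by (intro exI[of _ 1]) simp
  then show False using fat_point_schemeD(3)[OF assms ij(1,2,4)] by contradiction
qed

definition local_exponents :: "'k::field ^ 'v::finite \<Rightarrow> nat \<Rightarrow> nat \<Rightarrow> ('v \<Rightarrow>\<^sub>0 nat) set" where
  "local_exponents a m j = {e. total_degree e = j \<and> off_degree (pivot a) e < m}"

lemma order_ge_iff_local_coefficients:
  assumes "f \<in> forms j"
  shows "localize a f \<in> order_ge (pivot a) m \<longleftrightarrow>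
    (\<forall>e\<in>local_exponents a m j. Poly_Mapping.lookup (localize a f) e = 0)"
proof
  assume "localize a f \<in> order_ge (pivot a) m"
  then show "\<forall>e\<in>local_exponents a m j. Poly_Mapping.lookup (localize a f) e = 0"
    using order_ge_lookup unfolding local_exponents_def by blast
next
  assume *: "\<forall>e\<in>local_exponents a m j. Poly_Mapping.lookup (localize a f) e = 0"
  have "m \<le> off_degree (pivot a) e" if "e \<in> Poly_Mapping.keys (localize a f)" for e
  proof (rule ccontr)
    assume "\<not> m \<le> off_degree (pivot a) e"
    moreover have "total_degree e = j" using forms_localize[OF assms, of a] that by (auto simp: forms_alt)
    ultimately have "e \<in> local_exponents a m j" unfolding local_exponents_def by auto
    then show False using * that by (auto simp: in_keys_iff)
  qed
  then show "localize a f \<in> order_ge (pivot a) m" unfolding order_ge_def by blast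
qed

text \<open>
  The coefficients of order less than \<open>m i\<close> in the local expansions at the points \<open>P i\<close> are
  independent functionals on the forms of degree \<open>d * t\<close>: sorted by order, they are triangular with
  respect to the forms with prescribed leading monomials. For the point \<open>P i\<close> the labels are those
  of all other points, and the hypothesis on the sets \<open>Y\<close> that contain \<open>P i\<close> becomes the numerical
  condition on sets of labels.
\<close>

lemma quot_dim_scheme_ideal:
  assumes X: "fat_point_scheme s P m" and "s \<ge> 2" "d \<ge> 1"
    and bound: "\<And>Y. Y \<subseteq> scheme_supp s P \<Longrightarrow> card Y \<ge> 2 \<Longrightarrow>
      (\<Sum>i | i \<in> {1..s} \<and> P i \<in> Y. int (m i)) - 1 \<le> int t * (int (quot_dim (points_ideal Y) d) - 1)"
  shows "quot_dim (scheme_ideal s P m) (d * t) = scheme_deg s P m"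
proof -
  have nz: "P i \<noteq> 0" "m i > 0" if "i \<in> {1..s}" for i using fat_point_schemeD[OF X that] by auto
  have inj: "inj_on P {1..s}" by (rule fat_point_scheme_inj[OF X])
  \<comment> \<open>Two points impose at most two conditions, so they alone force \<open>t\<close> to be large enough
    for the local expansions up to order \<open>m i - 1\<close>.\<close>
  have m_le: "m i \<le> t" if i: "i \<in> {1..s}" for i
  proof -
    obtain j where j: "j \<in> {1..s}" "j \<noteq> i"
    proof (cases "i = 1")
      case True then show ?thesis using that[of 2] assms(2) by auto
    next
      case False then show ?thesis using that[of 1] assms(2) by auto
    qed
    have Pij: "P i \<noteq> P j" using inj_onD[OF inj _ i j(1)] j(2) by auto
    have "{k. k \<in> {1..s} \<and> P k \<in> {P i, P j}} = {i, j}"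
      using inj_onD[OF inj] i j(1) by blast
    then have "(\<Sum>k | k \<in> {1..s} \<and> P k \<in> {P i, P j}. int (m k)) = int (m i) + int (m j)" using j by simp
    moreover have "(\<Sum>k | k \<in> {1..s} \<and> P k \<in> {P i, P j}. int (m k)) - 1
        \<le> int t * (int (quot_dim (points_ideal {P i, P j}) d) - 1)"
      by (rule bound) (use i j Pij in \<open>auto simp: scheme_supp_def\<close>)
    moreover have "quot_dim (points_ideal {P i, P j}) d \<le> 2"
    proof -
      have "forms_space.codim d (evaluations {P i, P j}) \<le> card (evaluations {P i, P j})"
        by (rule forms_space.codim_le_card) (auto simp: functional_eval)
      also have "\<dots> \<le> card {P i, P j}" by (rule card_image_le) simp
      finally show ?thesis using Pij by (simp add: quot_dim_points_ideal)
    qed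
    then have "int t * (int (quot_dim (points_ideal {P i, P j}) d) - 1) \<le> int t * 1"
      by (intro mult_left_mono) auto
    ultimately show ?thesis using nz(2)[OF j(1)] by linarith
  qed
  define I where "I = (SIGMA i:{1..s}. local_exponents (P i) (m i) (d * t))"
  define \<Phi> where "\<Phi> x f = Poly_Mapping.lookup (localize (P (fst x)) f) (snd x)" for x f
  have finE: "finite (local_exponents a k j)" for a :: "'a ^ 'b" and k j
    unfolding local_exponents_def by (rule finite_subset[OF _ finite_total_degree[of j]]) auto
  have finI: "finite I" unfolding I_def using finE by auto
  have "forms_space.codim (d * t) (\<Phi> ` I) = card I"
  proof (rule forms_space.codim_triangular[where h = "\<lambda>x. off_degree (pivot (P (fst x))) (snd x)"])
    show "finite I" by (rule finI)
    show "forms_space.functional (\<Phi> x)" for x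
      unfolding \<Phi>_def using functional_local_coefficient .
    fix x assume "x \<in> I"
    then obtain i \<beta> where x: "x = (i, \<beta>)" "i \<in> {1..s}" "\<beta> \<in> local_exponents (P i) (m i) (d * t)"
      unfolding I_def by auto
    define k where "k = off_degree (pivot (P i)) \<beta>"
    have k: "k < m i" "total_degree \<beta> = d * t" using x(3) unfolding local_exponents_def k_def by auto
    define A where "A = (SIGMA j:{1..s} - {i}. {..<m j})"
    have finA: "finite A" unfolding A_def by auto
    have "\<exists>F\<in>forms (d * t). localize (P i) F - monomial \<beta> \<in> order_ge (pivot (P i)) (Suc k) \<and> vanishes_along (P \<circ> fst) A F"
    proof (rule exists_form_with_leading_monomial[OF _ finA _ assms(3)])
      show "P i \<noteq> 0" using nz x by auto
      show "k \<le> t" using k m_le[OF x(2)] by simp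
      show "total_degree \<beta> = d * t" "off_degree (pivot (P i)) \<beta> = k" using k k_def by auto
      fix B assume B: "B \<subseteq> A" "B \<noteq> {}"
      define N where "N = fst ` B"
      define Y where "Y = insert (P i) (P ` N)"
      have N: "N \<subseteq> {1..s}" "i \<notin> N" "N \<noteq> {}" "finite N"
        using B finite_subset[OF B(1) finA] unfolding N_def A_def by auto
      have YI: "{j. j \<in> {1..s} \<and> P j \<in> Y} = insert i N"
      proof -
        have "j \<in> insert i N" if j: "j \<in> {1..s}" "P j \<in> Y" for j
        proof -
          obtain k where k: "k \<in> insert i N" "P j = P k" using j(2) unfolding Y_def by blast
          then have "k \<in> {1..s}" using x(2) N(1) by blast
          then show ?thesis using inj_onD[OF inj k(2) j(1)] k(1) by simp
        qed
        then show ?thesis using x(2) N(1) unfolding Y_def by blast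
      qed
      have "B \<subseteq> (SIGMA j:N. {..<m j})" using B(1) unfolding N_def A_def by force
      then have "card B \<le> card (SIGMA j:N. {..<m j})" using N(4) by (intro card_mono) auto
      then have cB: "int (card B) \<le> (\<Sum>j\<in>N. int (m j))"
        using N(4) by (simp flip: of_nat_sum)
      have "card Y = card (insert i N)"
      proof -
        have "Y = P ` insert i N" unfolding Y_def by simp
        moreover have "inj_on P (insert i N)" by (rule inj_on_subset[OF inj]) (use N x in auto)
        ultimately show ?thesis by (simp only: card_image)
      qed
      then have "2 \<le> card Y" using N by (simp add: Suc_le_eq card_gt_0_iff)
      then have "(\<Sum>j | j \<in> {1..s} \<and> P j \<in> Y. int (m j)) - 1 \<le> int t * (int (quot_dim (points_ideal Y) d) - 1)"
        using N x by (intro bound) (auto simp: scheme_supp_def Y_def)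
      moreover have "(\<Sum>j | j \<in> {1..s} \<and> P j \<in> Y. int (m j)) = int (m i) + (\<Sum>j\<in>N. int (m j))"
        unfolding YI using N by simp
      moreover have "int (quot_dim (points_ideal Y) d) - 1 = relative_rank d (P i) (P \<circ> fst) B"
      proof -
        have "evaluations Y = {\<lambda>f. eval f (P i)} \<union> (\<lambda>e f. eval f ((P \<circ> fst) e)) ` B"
          unfolding Y_def N_def by auto
        then show ?thesis by (simp add: relative_rank_def quot_dim_points_ideal)
      qed
      ultimately show "int (card B) + int k \<le> int t * relative_rank d (P i) (P \<circ> fst) B"
        using cB k by simp
    qed
    then obtain F where F: "F \<in> forms (d * t)" "localize (P i) F - monomial \<beta> \<in> order_ge (pivot (P i)) (Suc k)"
      "vanishes_along (P \<circ> fst) A F" by blast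
    have low: "Poly_Mapping.lookup (localize (P i) F) e = Poly_Mapping.lookup (monomial \<beta>) e"
      if "off_degree (pivot (P i)) e \<le> k" for e
      using order_ge_lookup[OF F(2), of e] that by (simp add: lookup_minus)
    show "\<exists>f\<in>forms (d * t). \<Phi> x f \<noteq> 0 \<and> (\<forall>y\<in>I. y \<noteq> x \<longrightarrow>
      off_degree (pivot (P (fst y))) (snd y) \<le> off_degree (pivot (P (fst x))) (snd x) \<longrightarrow> \<Phi> y f = 0)"
    proof (intro bexI[of _ F] conjI ballI impI F(1))
      show "\<Phi> x F \<noteq> 0" using low[of \<beta>] x(1) k_def by (simp add: \<Phi>_def)
      fix y assume y: "y \<in> I" "y \<noteq> x"
        "off_degree (pivot (P (fst y))) (snd y) \<le> off_degree (pivot (P (fst x))) (snd x)"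
      obtain j \<gamma> where j: "y = (j, \<gamma>)" "j \<in> {1..s}" "\<gamma> \<in> local_exponents (P j) (m j) (d * t)"
        using y(1) unfolding I_def by auto
      show "\<Phi> y F = 0"
      proof (cases "j = i")
        case True
        then show ?thesis using low[of \<gamma>] y x(1) j(1) k_def by (simp add: \<Phi>_def lookup_single when_def)
      next
        case False
        have "{e \<in> A. (P \<circ> fst) e = P j} = {j} \<times> {..<m j}"
        proof -
          have "fst e = j" if "e \<in> A" "P (fst e) = P j" for e
            using inj_onD[OF inj that(2)] that(1) j(2) unfolding A_def by auto
          then show ?thesis using False j(2) unfolding A_def by force
        qed
        then have "card {e \<in> A. (P \<circ> fst) e = P j} = m j" by (simp add: card_cartesian_product)
        then have "localize (P j) F \<in> order_ge (pivot (P j)) (m j)"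
          using F(3) unfolding vanishes_along_def by metis
        then show ?thesis using j(3) order_ge_lookup j(1) unfolding \<Phi>_def local_exponents_def by fastforce
      qed
    qed
  qed
  moreover have "quot_dim (scheme_ideal s P m) (d * t) = forms_space.codim (d * t) (\<Phi> ` I)"
  proof (rule quot_dim_eq_codim)
    show "f \<in> scheme_ideal s P m \<longleftrightarrow> (\<forall>\<phi>\<in>\<Phi> ` I. \<phi> f = 0)" if "f \<in> forms (d * t)" for f
    proof -
      have "f \<in> scheme_ideal s P m \<longleftrightarrow> (\<forall>i\<in>{1..s}. localize (P i) f \<in> order_ge (pivot (P i)) (m i))"
        by (rule scheme_ideal_iff) (rule nz(1))
      also have "\<dots> \<longleftrightarrow> (\<forall>\<phi>\<in>\<Phi> ` I. \<phi> f = 0)"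
        unfolding order_ge_iff_local_coefficients[OF that] by (auto simp: \<Phi>_def I_def)
      finally show ?thesis .
    qed
  qed (auto simp: scheme_ideal_def ideal_pow_def ideal_gen_zero ideal_gen_add ideal_gen_mult)
  moreover have "card I = scheme_deg s P m"
  proof -
    have "card I = (\<Sum>i\<in>{1..s}. card (local_exponents (P i) (m i) (d * t)))"
      unfolding I_def using finE by (simp add: card_SigmaI)
    also have "\<dots> = (\<Sum>i\<in>{1..s}. (m i + (CARD('b) - 1) - 1) choose (CARD('b) - 1))"
    proof (rule sum.cong[OF refl])
      fix i assume i: "i \<in> {1..s}"
      have "t \<le> d * t" using assms(3) by simp
      then show "card (local_exponents (P i) (m i) (d * t)) = (m i + (CARD('b) - 1) - 1) choose (CARD('b) - 1)"
        unfolding local_exponents_def using nz(2)[OF i] m_le[OF i] by (intro card_off_degree_less) linarith+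
    qed
    finally show ?thesis by (simp add: scheme_deg_def Let_def)
  qed
  ultimately show ?thesis by simp
qed

lemma quot_dim_points_ideal_ge_2:
  assumes X: "fat_point_scheme s P m" and Y: "Y \<subseteq> scheme_supp s P" "card Y \<ge> 2" and d: "d \<ge> 1"
  shows "quot_dim (points_ideal Y) d \<ge> 2"
proof -
  obtain a b where ab: "a \<in> Y" "b \<in> Y" "a \<noteq> b"
    by (metis Y(2) card_le_Suc0_iff_eq card.infinite not_less_eq_eq numeral_2_eq_2 zero_le)
  obtain i j where ij: "i \<in> {1..s}" "j \<in> {1..s}" "a = P i" "b = P j"
    using ab(1,2) Y(1) unfolding scheme_supp_def by (meson imageE subsetD)
  then have "forms_space.codim d {\<lambda>f. eval f b, \<lambda>f. eval f a} = 2"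
  proof (intro codim_two_points d)
    show "a \<noteq> 0" "b \<noteq> 0" using fat_point_schemeD(1)[OF X] ij by simp_all
    have "j \<noteq> i" using ab(3) ij(3,4) by auto
    then show "\<not> same_point b a" using fat_point_schemeD(3)[OF X ij(2,1)] ij(3,4) by simp
  qed
  moreover have "forms_space.codim d {\<lambda>f. eval f b, \<lambda>f. eval f a} \<le> forms_space.codim d (evaluations Y)"
    by (rule forms_space.codim_mono) (use ab in auto)
  ultimately show ?thesis by (simp add: quot_dim_points_ideal)
qed

theorem proposition5p6:
  fixes P :: "nat \<Rightarrow> 'k::field ^ 'v::finite" and m :: "nat \<Rightarrow> nat" and s d :: nat
  assumes "fat_point_scheme s P m" and "s \<ge> 2" and "d \<ge> 1"
  shows "int (reg_index s P m) \<le>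
    Max {int d * \<lceil>(- 1 + (\<Sum>i | i \<in> {1..s} \<and> P i \<in> Y. real (m i))) /
                   (real (quot_dim (points_ideal Y) d) - 1)\<rceil>
         | Y. Y \<subseteq> scheme_supp s P \<and> card Y \<ge> 2}"
proof -
  define z where "z Y = \<lceil>(- 1 + (\<Sum>i | i \<in> {1..s} \<and> P i \<in> Y. real (m i))) /
                   (real (quot_dim (points_ideal Y) d) - 1)\<rceil>" for Y
  define \<Y> where "\<Y> = {Y. Y \<subseteq> scheme_supp s P \<and> card Y \<ge> 2}"
  have "finite (scheme_supp s P)" unfolding scheme_supp_def by simp
  then have fin: "finite \<Y>" unfolding \<Y>_def by simp
  have S: "{int d * z Y | Y. Y \<subseteq> scheme_supp s P \<and> card Y \<ge> 2} = (\<lambda>Y. int d * z Y) ` \<Y>"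
    unfolding \<Y>_def by auto
  have "P 1 \<noteq> P 2"
    using inj_onD[OF fat_point_scheme_inj[OF assms(1)], of 1 2] assms(2) by auto
  then have "{P 1, P 2} \<in> \<Y>" using assms(2) unfolding \<Y>_def scheme_supp_def by auto
  then have ne: "\<Y> \<noteq> {}" by auto
  obtain Y0 where Y0: "Y0 \<in> \<Y>" "Max ((\<lambda>Y. int d * z Y) ` \<Y>) = int d * z Y0"
  proof -
    have "Max ((\<lambda>Y. int d * z Y) ` \<Y>) \<in> (\<lambda>Y. int d * z Y) ` \<Y>"
      using fin ne by (intro Max_in) auto
    then show ?thesis using that by blast
  qed
  have z_le: "z Y \<le> z Y0" if "Y \<in> \<Y>" for Y
  proof -
    have "int d * z Y \<le> int d * z Y0"
      unfolding Y0(2)[symmetric] using fin that by (intro Max_ge) auto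
    then show ?thesis using assms(3) by simp
  qed
  have main: "(\<Sum>i | i \<in> {1..s} \<and> P i \<in> Y. int (m i)) - 1 \<le> z Y0 * (int (quot_dim (points_ideal Y) d) - 1)"
    if Y: "Y \<subseteq> scheme_supp s P" "card Y \<ge> 2" for Y
  proof -
    let ?S = "\<Sum>i | i \<in> {1..s} \<and> P i \<in> Y. int (m i)" and ?q = "quot_dim (points_ideal Y) d"
    have q: "?q \<ge> 2" by (rule quot_dim_points_ideal_ge_2[OF assms(1) Y assms(3)])
    have "z Y \<le> z Y0" using z_le Y unfolding \<Y>_def by auto
    then have "(- 1 + real_of_int ?S) / (real ?q - 1) \<le> real_of_int (z Y0)"
      unfolding z_def by (simp add: ceiling_le_iff)
    then have "- 1 + real_of_int ?S \<le> real_of_int (z Y0) * (real ?q - 1)"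
      using q by (simp add: pos_divide_le_eq)
    then have "real_of_int (?S - 1) \<le> real_of_int (z Y0 * (int ?q - 1))" by simp
    then show ?thesis by (simp only: of_int_le_iff)
  qed
  \<comment> \<open>Needed to use the integer \<open>z Y0\<close> as a number of factors.\<close>
  have z_nonneg: "0 \<le> z Y0"
  proof (rule ccontr)
    assume neg: "\<not> 0 \<le> z Y0"
    have Y0': "Y0 \<subseteq> scheme_supp s P" "card Y0 \<ge> 2" using Y0(1) unfolding \<Y>_def by auto
    then obtain b where "b \<in> Y0" by fastforce
    then obtain i where i: "i \<in> {1..s}" "P i \<in> Y0" using Y0'(1) unfolding scheme_supp_def by auto
    then have "int (m i) \<le> (\<Sum>i | i \<in> {1..s} \<and> P i \<in> Y0. int (m i))" by (intro member_le_sum) auto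
    moreover have "int (m i) > 0" using assms(1) i unfolding fat_point_scheme_def by auto
    moreover have "z Y0 * (int (quot_dim (points_ideal Y0) d) - 1) < 0"
      using neg quot_dim_points_ideal_ge_2[OF assms(1) Y0' assms(3)] by (intro mult_neg_pos) auto
    ultimately show False using main[OF Y0'] by linarith
  qed
  have "quot_dim (scheme_ideal s P m) (d * nat (z Y0)) = scheme_deg s P m"
    by (rule quot_dim_scheme_ideal[OF assms]) (use main z_nonneg in auto)
  then have "reg_index s P m \<le> d * nat (z Y0)" unfolding reg_index_def by (rule Least_le)
  then have "int (reg_index s P m) \<le> int d * z Y0"
    using z_nonneg by (metis int_nat_eq of_nat_le_iff of_nat_mult)
  then show ?thesis using Y0(2) S unfolding z_def by simp
qed

end
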